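(* Suppose $X$ has an indefinite Wiener integral. Then the following are equivalent: (i) $X$ is not a martingale (with respect to its own filtration); (ii) there are $h\in H_X$ and $r\in[0,T]$ such that $\mathbb E\left[\widetilde E\left[h\,|\,\mathcal F^X_r\right]^2\right]>\mathbb E\left[h^2\right]$.
   Context: Let $T>0$ and let $X=(X_t)_{t\in[0,T]}$ be a measurable centered Gaussian process with $X_0=0$ on a complete probability space $(\Omega,\mathcal F,P)$, with covariance $R(t,s)=\mathbb E[X_tX_s]$. Let $(\mathcal F^X_t)_{t\in[0,T]}$ be the filtration generated by $X$ and $L^2_X=L^2(\Omega,\mathcal F^X_T,P)$. The first chaos $H_X$ is the closure in $L^2_X$ of $\mathrm{span}\{X_s:0\le s\le T\}$. The space of deterministic integrands $\mathfrak H=\mathfrak H_X$ is the Hilbert space obtained as closure (completion) of the linear span of the indicator functions $\mathbf 1_{(0,t]}$, $t\in[0,T]$, with inner product $\langle \mathbf 1_{(0,t]},\mathbf 1_{(0,s]}\rangle_{\mathfrak H}=R(t,s)$. The Wiener integral $I:\mathfrak H\to H_X$ is the unique linear isometry with $I(\mathbf 1_{(0,t]})=X_t$. For $h\in H_X$, the Wick exponential is $e^{\diamond h}=\exp\{h-\frac12\mathbb E[h^2]\}$. The $S$-transform of $\xi\in L^2_X$ is $(S\xi)(\mathfrak h)=\mathbb E[\xi e^{\diamond I(\mathfrak h)}]$, $\mathfrak h\in\mathfrak H$; it determines $\xi$ uniquely. $X$ has an indefinite Wiener integral if for every $r\in[0,T]$ there is a continuous linear operator $\mathbb I_r:\mathfrak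 H\to\mathfrak H$ with $\mathbb I_r(\mathbf 1_{(0,t]})=\mathbf 1_{(0,t\wedge r]}$ for all $t\in[0,T]$. In this case $\mathbb I_r^*$ denotes the adjoint and $\mathfrak h^r:=\mathbb I_r^*\mathfrak h$. For $r\in[0,T]$, let $$D_r=\left\{\xi\in L^2_X:\ \exists\,\eta\in L^2_X\text{ such that }(S\xi)(\mathfrak h^r)=(S\eta)(\mathfrak h)\ \ \forall\,\mathfrak h\in\mathfrak H\right\}.$$ For $\xi\in D_r$ the corresponding $\eta$ is unique, is called the quasi-conditional expectation of $\xi$ and denoted $\widetilde E[\xi|\mathcal F^X_r]$. (One has $H_X\subset D_r$ for every $r$.) *)

theory Defs
  imports "HOL-Probability.Probability"
begin

text \<open>
  A process on $[0,T]$ is a family \<open>X :: real \<Rightarrow> 'a \<Rightarrow> real\<close> of which only the members with index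
  in \<open>{0..T}\<close> matter. Elements of $L^2$ are represented by functions; identities between random
  variables are understood almost everywhere.
\<close>

definition measurable_process :: "'a measure \<Rightarrow> real \<Rightarrow> (real \<Rightarrow> 'a \<Rightarrow> real) \<Rightarrow> bool" where
  "measurable_process M T X \<longleftrightarrow>
     (\<lambda>(t, \<omega>). X t \<omega>) \<in> borel_measurable (restrict_space borel {0..T} \<Otimes>\<^sub>M M)"

text \<open>Degenerate normal distributions (point masses) count as Gaussian.\<close>

definition gaussian_rv :: "'a measure \<Rightarrow> ('a \<Rightarrow> real) \<Rightarrow> bool" where
  "gaussian_rv M Y \<longleftrightarrow> Y \<in> borel_measurable M \<and>
     (\<exists>\<mu> \<sigma>. 0 \<le> \<sigma> \<and>
        (if \<sigma> = 0 then AE \<omega> in M. Y \<omega> = \<mu>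
         else distributed M lborel Y (\<lambda>x. ennreal (normal_density \<mu> \<sigma> x))))"

definition centered_gaussian_process :: "'a measure \<Rightarrow> real \<Rightarrow> (real \<Rightarrow> 'a \<Rightarrow> real) \<Rightarrow> bool" where
  "centered_gaussian_process M T X \<longleftrightarrow>
     (\<forall>F c. finite F \<and> F \<subseteq> {0..T} \<longrightarrow> gaussian_rv M (\<lambda>\<omega>. \<Sum>t\<in>F. c t * X t \<omega>)) \<and>
     (\<forall>t\<in>{0..T}. (\<integral>\<omega>. X t \<omega> \<partial>M) = 0)"

definition covariance :: "'a measure \<Rightarrow> (real \<Rightarrow> 'a \<Rightarrow> real) \<Rightarrow> real \<Rightarrow> real \<Rightarrow> real" where
  "covariance M X t s = (\<integral>\<omega>. X t \<omega> * X s \<omega> \<partial>M)"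

definition natural_filtration :: "'a measure \<Rightarrow> (real \<Rightarrow> 'a \<Rightarrow> real) \<Rightarrow> real \<Rightarrow> 'a measure" where
  "natural_filtration M X t =
     sigma (space M) {X s -` B \<inter> space M | s B. s \<in> {0..t} \<and> B \<in> sets borel}"

definition martingale_own_filtration :: "'a measure \<Rightarrow> real \<Rightarrow> (real \<Rightarrow> 'a \<Rightarrow> real) \<Rightarrow> bool" where
  "martingale_own_filtration M T X \<longleftrightarrow>
     (\<forall>t\<in>{0..T}. X t \<in> borel_measurable (natural_filtration M X t) \<and> integrable M (X t)) \<and>
     (\<forall>s t. 0 \<le> s \<and> s \<le> t \<and> t \<le> T \<longrightarrow>
        (AE \<omega> in M. real_cond_exp M (natural_filtration M X s) (X t) \<omega> = X s \<omega>))"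

definition L2_X :: "'a measure \<Rightarrow> real \<Rightarrow> (real \<Rightarrow> 'a \<Rightarrow> real) \<Rightarrow> ('a \<Rightarrow> real) set" where
  "L2_X M T X = {\<xi>. \<xi> \<in> borel_measurable (natural_filtration M X T) \<and>
                    integrable M (\<lambda>\<omega>. (\<xi> \<omega>)\<^sup>2)}"

definition first_chaos :: "'a measure \<Rightarrow> real \<Rightarrow> (real \<Rightarrow> 'a \<Rightarrow> real) \<Rightarrow> ('a \<Rightarrow> real) set" where
  "first_chaos M T X = {\<xi> \<in> L2_X M T X. \<forall>\<epsilon>>0. \<exists>F c. finite F \<and> F \<subseteq> {0..T} \<and>
      (\<integral>\<omega>. (\<xi> \<omega> - (\<Sum>t\<in>F. c t * X t \<omega>))\<^sup>2 \<partial>M) < \<epsilon>}"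

text \<open>The linear span of the functions $\mathbf 1_{(0,t]}$, $t \in [0,T]$.\<close>

definition step_functions :: "real \<Rightarrow> (real \<Rightarrow> real) set" where
  "step_functions T =
     {\<lambda>u. \<Sum>t\<in>F. c t * indicat_real {0<..t} u | F c. finite F \<and> F \<subseteq> {0..T}}"

text \<open>
  The type \<open>'h\<close>, with the map \<open>J\<close>, is a Hilbert space completion of the step functions for the
  (semi-)inner product with $\langle \mathbf 1_{(0,t]}, \mathbf 1_{(0,s]}\rangle = R(t,s)$: \<open>J\<close> is
  linear on step functions, carries this inner product to that of \<open>'h\<close>, and has dense image.
  This determines \<open>('h, J)\<close> up to a unique isometric isomorphism. \<open>J\<close> need not be injective,
  since \<open>R\<close> may be degenerate. In what follows \<open>J (indicat_real {0<..t})\<close> is the integrand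
  $\mathbf 1_{(0,t]}$.
\<close>

definition integrand_space ::
  "'a measure \<Rightarrow> real \<Rightarrow> (real \<Rightarrow> 'a \<Rightarrow> real) \<Rightarrow> ((real \<Rightarrow> real) \<Rightarrow> 'h::{real_inner, complete_space}) \<Rightarrow> bool"
  where
  "integrand_space M T X J \<longleftrightarrow>
     (\<forall>f\<in>step_functions T. \<forall>g\<in>step_functions T. \<forall>a b.
        J (\<lambda>u. a * f u + b * g u) = a *\<^sub>R J f + b *\<^sub>R J g) \<and>
     (\<forall>t\<in>{0..T}. \<forall>s\<in>{0..T}.
        J (indicat_real {0<..t}) \<bullet> J (indicat_real {0<..s}) = covariance M X t s) \<and>
     closure (J ` step_functions T) = UNIV"

definition is_wiener_integral ::
  "'a measure \<Rightarrow> real \<Rightarrow> (real \<Rightarrow> 'a \<Rightarrow> real) \<Rightarrow> ((real \<Rightarrow> real) \<Rightarrow> 'h::{real_inner, complete_space}) \<Rightarrow>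
   ('h \<Rightarrow> 'a \<Rightarrow> real) \<Rightarrow> bool" where
  "is_wiener_integral M T X J I \<longleftrightarrow>
     (\<forall>g. I g \<in> first_chaos M T X) \<and>
     (\<forall>f g a b. AE \<omega> in M. I (a *\<^sub>R f + b *\<^sub>R g) \<omega> = a * I f \<omega> + b * I g \<omega>) \<and>
     (\<forall>f g. (\<integral>\<omega>. I f \<omega> * I g \<omega> \<partial>M) = f \<bullet> g) \<and>
     (\<forall>t\<in>{0..T}. AE \<omega> in M. I (J (indicat_real {0<..t})) \<omega> = X t \<omega>)"

text \<open>Unique up to null sets.\<close>

definition wiener_integral ::
  "'a measure \<Rightarrow> real \<Rightarrow> (real \<Rightarrow> 'a \<Rightarrow> real) \<Rightarrow> ((real \<Rightarrow> real) \<Rightarrow> 'h::{real_inner, complete_space}) \<Rightarrow>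
   'h \<Rightarrow> 'a \<Rightarrow> real" where
  "wiener_integral M T X J = (SOME I. is_wiener_integral M T X J I)"

definition wick_exp :: "'a measure \<Rightarrow> ('a \<Rightarrow> real) \<Rightarrow> 'a \<Rightarrow> real" where
  "wick_exp M h = (\<lambda>\<omega>. exp (h \<omega> - (1 / 2) * (\<integral>\<omega>'. (h \<omega>')\<^sup>2 \<partial>M)))"

definition S_transform ::
  "'a measure \<Rightarrow> real \<Rightarrow> (real \<Rightarrow> 'a \<Rightarrow> real) \<Rightarrow> ((real \<Rightarrow> real) \<Rightarrow> 'h::{real_inner, complete_space}) \<Rightarrow>
   ('a \<Rightarrow> real) \<Rightarrow> 'h \<Rightarrow> real" where
  "S_transform M T X J \<xi> f = (\<integral>\<omega>. \<xi> \<omega> * wick_exp M (wiener_integral M T X J f) \<omega> \<partial>M)"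

definition is_indefinite_op ::
  "real \<Rightarrow> ((real \<Rightarrow> real) \<Rightarrow> 'h::{real_inner, complete_space}) \<Rightarrow> real \<Rightarrow> ('h \<Rightarrow> 'h) \<Rightarrow> bool" where
  "is_indefinite_op T J r L \<longleftrightarrow> bounded_linear L \<and>
     (\<forall>t\<in>{0..T}. L (J (indicat_real {0<..t})) = J (indicat_real {0<..min t r}))"

definition has_indefinite_wiener_integral ::
  "real \<Rightarrow> ((real \<Rightarrow> real) \<Rightarrow> 'h::{real_inner, complete_space}) \<Rightarrow> bool" where
  "has_indefinite_wiener_integral T J \<longleftrightarrow> (\<forall>r\<in>{0..T}. \<exists>L. is_indefinite_op T J r L)"

definition indefinite_op ::
  "real \<Rightarrow> ((real \<Rightarrow> real) \<Rightarrow> 'h::{real_inner, complete_space}) \<Rightarrow> real \<Rightarrow> 'h \<Rightarrow> 'h" where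
  "indefinite_op T J r = (SOME L. is_indefinite_op T J r L)"

text \<open>The integrand $\mathfrak h^r = \mathbb I_r^* \mathfrak h$.\<close>

definition restricted_integrand ::
  "real \<Rightarrow> ((real \<Rightarrow> real) \<Rightarrow> 'h::{real_inner, complete_space}) \<Rightarrow> real \<Rightarrow> 'h \<Rightarrow> 'h" where
  "restricted_integrand T J r = adjoint (indefinite_op T J r)"

definition is_quasi_cond_exp ::
  "'a measure \<Rightarrow> real \<Rightarrow> (real \<Rightarrow> 'a \<Rightarrow> real) \<Rightarrow> ((real \<Rightarrow> real) \<Rightarrow> 'h::{real_inner, complete_space}) \<Rightarrow>
   real \<Rightarrow> ('a \<Rightarrow> real) \<Rightarrow> ('a \<Rightarrow> real) \<Rightarrow> bool" where
  "is_quasi_cond_exp M T X J r \<xi> \<eta> \<longleftrightarrow> \<eta> \<in> L2_X M T X \<and>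
     (\<forall>f. S_transform M T X J \<xi> (restricted_integrand T J r f) = S_transform M T X J \<eta> f)"

definition quasi_cond_exp_domain ::
  "'a measure \<Rightarrow> real \<Rightarrow> (real \<Rightarrow> 'a \<Rightarrow> real) \<Rightarrow> ((real \<Rightarrow> real) \<Rightarrow> 'h::{real_inner, complete_space}) \<Rightarrow>
   real \<Rightarrow> ('a \<Rightarrow> real) set" where
  "quasi_cond_exp_domain M T X J r = {\<xi> \<in> L2_X M T X. \<exists>\<eta>. is_quasi_cond_exp M T X J r \<xi> \<eta>}"

text \<open>
  On \<open>quasi_cond_exp_domain\<close> this is determined up to null sets; the first chaos is contained in
  that domain for every \<open>r\<close> in \<open>{0..T}\<close>.
\<close>

definition quasi_cond_exp ::
  "'a measure \<Rightarrow> real \<Rightarrow> (real \<Rightarrow> 'a \<Rightarrow> real) \<Rightarrow> ((real \<Rightarrow> real) \<Rightarrow> 'h::{real_inner, complete_space}) \<Rightarrow>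
   real \<Rightarrow> ('a \<Rightarrow> real) \<Rightarrow> 'a \<Rightarrow> real" where
  "quasi_cond_exp M T X J r \<xi> = (SOME \<eta>. is_quasi_cond_exp M T X J r \<xi> \<eta>)"

end

theory Submission
  imports Defs
begin

text \<open>
  Write $I$ for the Wiener integral. For every integrand $g$ the $S$-transform of $I(g)$ is linear,
  $S(I(g))(f) = \langle g, f\rangle$. Hence
  $S(I(g))(\mathbb I_r^* f) = \langle g, \mathbb I_r^* f\rangle = \langle \mathbb I_r g, f\rangle$,
  so $I(\mathbb I_r g)$ is a quasi-conditional expectation of $I(g)$. As $I$ is an isometry from
  the integrands onto the first chaos, the second moment grows for some $h$ and $r$ exactly when
  some operator $\mathbb I_r$ is not a contraction (\<open>second_moment_increases_iff\<close>).

  It remains to see that $X$ is a martingale exactly when all $\mathbb I_r$ are contractions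
  (\<open>martingale_iff_trunc_contraction\<close>). The link is the condition that every increment
  $\mathbf 1_{(0,t]} - \mathbf 1_{(0,r]}$ with $r \le t$ is orthogonal to every $\mathbf 1_{(0,u]}$
  with $u \le r$. Now $\mathbb I_r$ kills such an increment and fixes $\mathbf 1_{(0,u]}$. If the
  two are orthogonal, then $\mathbb I_r$ is an orthogonal projection on step functions, hence a
  contraction; conversely a contraction makes the vectors it kills orthogonal to the vectors it
  fixes. In terms of $X$ the condition says that $X_t - X_r$ is uncorrelated with the past up to
  $r$, which a martingale satisfies and which suffices because the variables are Gaussian.

  Both uses of Gaussianity go through \<open>laplace_null_imp_null_on_sigma_algebra\<close>: a
  square-integrable $\xi$ with $E[\xi e^{I(f)}] = 0$ for all $f$ in a subspace $V$ has integral $0$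
  over every event generated by versions of the variables $I(v)$ with $v \in V$. For $V$ the whole space this is the
  injectivity of the $S$-transform, which makes the quasi-conditional expectation unique. For $V$ the
  span of the $\mathbf 1_{(0,u]}$ with $u \le r$ and $\xi = X_t - X_r$ it computes the conditional
  expectation given the past. The hypothesis is checked with $E[I(g) e^{I(f)}] = \langle g, f\rangle e^{\|f\|^2/2}$.
\<close>

section \<open>Bounded operators on a real Hilbert space\<close>

lemma linear_coefficient_zero_if_quadratic_nonneg:
  fixes a b :: real
  assumes "\<And>t. 0 \<le> t\<^sup>2 * a + 2 * t * b"
  shows "b = 0"
proof (rule ccontr)
  assume "b \<noteq> 0"
  show False
  proof (cases "a > 0")
    case True
    have "0 \<le> (- b / a)\<^sup>2 * a + 2 * (- b / a) * b" by (rule assms)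
    also have "\<dots> = - b\<^sup>2 / a" using True by (simp add: power2_eq_square field_simps)
    finally show False using True \<open>b \<noteq> 0\<close> by (simp add: field_simps)
  next
    case False
    have "0 \<le> (- b)\<^sup>2 * a + 2 * (- b) * b" by (rule assms)
    moreover have "(- b)\<^sup>2 * a \<le> 0" using False by (simp add: mult_nonneg_nonpos)
    moreover have "b * b > 0" using \<open>b \<noteq> 0\<close> by (cases b "0::real" rule: linorder_cases) (simp_all add: mult_neg_neg)
    ultimately show False by simp
  qed
qed

text \<open>
  The representing vector is the minimiser of $\|x\|^2 - 2 \phi(x)$. The parallelogram law makes
  minimising sequences Cauchy, and the first-order condition at the minimum is the representation.
\<close>

theorem Riesz_representation:
  fixes \<phi> :: "'h::{real_inner, complete_space} \<Rightarrow> real"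
  assumes "bounded_linear \<phi>"
  obtains v where "\<And>x. \<phi> x = x \<bullet> v"
proof -
  interpret bounded_linear \<phi> by fact
  obtain K where K: "\<And>x. norm (\<phi> x) \<le> norm x * K" using bounded by blast
  define F where "F x = (norm x)\<^sup>2 - 2 * \<phi> x" for x
  have F_lower: "F x \<ge> - K\<^sup>2" for x
  proof -
    have "\<phi> x \<le> norm x * K" using K[of x] by simp
    moreover have "0 \<le> (norm x - K)\<^sup>2" by simp
    ultimately show ?thesis unfolding F_def power2_diff by (simp add: algebra_simps)
  qed
  define m where "m = Inf (range F)"
  have bdd: "bdd_below (range F)" using F_lower by (auto intro!: bdd_belowI)
  have m_le: "m \<le> F x" for x unfolding m_def by (intro cInf_lower bdd) auto
  have "\<exists>x. F x < m + 1 / real (Suc n)" for n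
    using cInf_lessD[of "range F" "m + 1 / real (Suc n)"] unfolding m_def by auto
  then obtain x where x: "\<And>n. F (x n) < m + 1 / real (Suc n)" by metis
  have dist_le: "(norm (y - z))\<^sup>2 \<le> 2 * (F y - m) + 2 * (F z - m)" for y z
  proof -
    have "(norm (y - z))\<^sup>2 = 2 * F y + 2 * F z - 4 * F ((1/2) *\<^sub>R (y + z))"
      unfolding F_def by (simp add: power2_norm_eq_inner scaleR add algebra_simps inner_commute)
    with m_le[of "(1/2) *\<^sub>R (y + z)"] show ?thesis by simp
  qed
  have "Cauchy x"
  proof (rule CauchyI)
    fix e :: real assume e: "0 < e"
    then obtain N where N: "inverse (real (Suc N)) < e\<^sup>2 / 4"
      using reals_Archimedean[of "e\<^sup>2 / 4"] by auto
    have "norm (x i - x j) < e" if "N \<le> i" "N \<le> j" for i j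
    proof -
      have *: "F (x k) - m < e\<^sup>2 / 4" if "N \<le> k" for k
      proof -
        have "1 / real (Suc k) \<le> inverse (real (Suc N))"
          using that by (simp add: field_simps)
        then show ?thesis using x[of k] N by linarith
      qed
      have "(norm (x i - x j))\<^sup>2 < e\<^sup>2"
        using dist_le[of "x i" "x j"] *[OF \<open>N \<le> i\<close>] *[OF \<open>N \<le> j\<close>] by argo
      then show ?thesis using e by (simp add: power_less_imp_less_base)
    qed
    then show "\<exists>N. \<forall>i\<ge>N. \<forall>j\<ge>N. norm (x i - x j) < e" by blast
  qed
  then obtain v where v: "x \<longlonglongrightarrow> v" using Cauchy_convergent_iff convergent_def by blast
  have "(\<lambda>n. F (x n)) \<longlonglongrightarrow> F v" unfolding F_def by (intro tendsto_intros v tendsto)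
  moreover have "(\<lambda>n. m + 1 / real (Suc n)) \<longlonglongrightarrow> m + 0"
    by (intro tendsto_intros) (use LIMSEQ_inverse_real_of_nat in \<open>simp add: inverse_eq_divide\<close>)
  ultimately have "F v \<le> m + 0"
    by (rule LIMSEQ_le) (use x in \<open>auto intro: less_imp_le\<close>)
  have "\<phi> y = y \<bullet> v" for y
  proof -
    have "0 \<le> t\<^sup>2 * (norm y)\<^sup>2 + 2 * t * (y \<bullet> v - \<phi> y)" for t
    proof -
      have "F v \<le> F (v + t *\<^sub>R y)" using \<open>F v \<le> m + 0\<close> m_le[of "v + t *\<^sub>R y"] by simp
      also have "\<dots> = F v + t\<^sup>2 * (norm y)\<^sup>2 + 2 * t * (y \<bullet> v - \<phi> y)"
        unfolding F_def power2_norm_eq_inner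
        by (simp add: scaleR add algebra_simps inner_commute power2_eq_square)
      finally show ?thesis by simp
    qed
    from linear_coefficient_zero_if_quadratic_nonneg[OF this] show ?thesis by simp
  qed
  then show thesis by (rule that)
qed

text \<open>
  \<open>adjoint\<close> chooses some function satisfying the adjoint identity; on a complete space the Riesz
  representation shows that there is one to choose.
\<close>

lemma adjoint_works_complete:
  fixes L :: "'h::{real_inner, complete_space} \<Rightarrow> 'h"
  assumes "bounded_linear L"
  shows "L x \<bullet> y = x \<bullet> adjoint L y"
proof -
  have "\<exists>v. \<forall>x. L x \<bullet> y = x \<bullet> v" for y
  proof -
    have "bounded_linear (\<lambda>x. L x \<bullet> y)"
      using bounded_linear_compose[OF bounded_linear_inner_left assms] by simp
    from Riesz_representation[OF this] show ?thesis by metis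
  qed
  then obtain f' where "\<forall>y x. L x \<bullet> y = x \<bullet> f' y" by metis
  then have "\<forall>x y. L x \<bullet> y = x \<bullet> f' y" by blast
  then have "\<forall>x y. L x \<bullet> y = x \<bullet> adjoint L y" 
    unfolding adjoint_def by (rule someI[of "\<lambda>f'. \<forall>x y. L x \<bullet> y = x \<bullet> f' y"])
  then show ?thesis by blast
qed

text \<open>
  Adding multiples of \<open>u\<close> to \<open>v\<close> does not change the image \<open>v\<close>, so under a contraction \<open>v\<close> is
  the shortest vector on the line through \<open>v\<close> in direction \<open>u\<close>.
\<close>

lemma contraction_kernel_orthogonal_fixed:
  fixes L :: "'h::real_inner \<Rightarrow> 'h"
  assumes "linear L" and contr: "\<And>x. norm (L x) \<le> norm x"
    and "L u = 0" and "L v = v"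
  shows "u \<bullet> v = 0"
proof -
  interpret linear L by fact
  have "0 \<le> t\<^sup>2 * (norm u)\<^sup>2 + 2 * t * (u \<bullet> v)" for t
  proof -
    have "L (v + t *\<^sub>R u) = v" using assms by (simp add: add scale)
    then have "(norm v)\<^sup>2 \<le> (norm (v + t *\<^sub>R u))\<^sup>2" using contr[of "v + t *\<^sub>R u"] by simp
    also have "\<dots> = (norm v)\<^sup>2 + t\<^sup>2 * (norm u)\<^sup>2 + 2 * t * (u \<bullet> v)"
      unfolding power2_norm_eq_inner by (simp add: algebra_simps inner_commute power2_eq_square)
    finally show ?thesis by simp
  qed
  from linear_coefficient_zero_if_quadratic_nonneg[OF this] show ?thesis .
qed

section \<open>Square-integrable random variables\<close>

definition square_integrable :: "'a measure \<Rightarrow> ('a \<Rightarrow> real) \<Rightarrow> bool" where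
  "square_integrable M x \<longleftrightarrow> x \<in> borel_measurable M \<and> integrable M (\<lambda>\<omega>. (x \<omega>)\<^sup>2)"

definition L2_norm :: "'a measure \<Rightarrow> ('a \<Rightarrow> real) \<Rightarrow> real" where
  "L2_norm M x = sqrt (\<integral>\<omega>. (x \<omega>)\<^sup>2 \<partial>M)"

lemma L2_norm_nonneg: "0 \<le> L2_norm M x"
  unfolding L2_norm_def by simp

lemma L2_norm_power2: "(L2_norm M x)\<^sup>2 = (\<integral>\<omega>. (x \<omega>)\<^sup>2 \<partial>M)"
  unfolding L2_norm_def by simp

lemma L2_norm_zero: "L2_norm M (\<lambda>\<omega>. 0) = 0"
  unfolding L2_norm_def by simp

lemma L2_norm_minus_commute: "L2_norm M (\<lambda>\<omega>. x \<omega> - y \<omega>) = L2_norm M (\<lambda>\<omega>. y \<omega> - x \<omega>)"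
  unfolding L2_norm_def by (simp add: power2_commute)

lemma square_integrable_measurable [measurable_dest]:
  "square_integrable M x \<Longrightarrow> x \<in> borel_measurable M"
  unfolding square_integrable_def by simp

lemma square_integrable_mult:
  assumes "square_integrable M x" "square_integrable M y"
  shows "integrable M (\<lambda>\<omega>. x \<omega> * y \<omega>)"
proof (rule Bochner_Integration.integrable_bound)
  show "integrable M (\<lambda>\<omega>. (x \<omega>)\<^sup>2 + (y \<omega>)\<^sup>2)"
    using assms unfolding square_integrable_def by simp
  show "(\<lambda>\<omega>. x \<omega> * y \<omega>) \<in> borel_measurable M" using assms by measurable
  have "norm (a * b) \<le> norm (a\<^sup>2 + b\<^sup>2)" for a b :: real
  proof -
    have "0 \<le> (\<bar>a\<bar> - \<bar>b\<bar>)\<^sup>2" by simp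
    then have "2 * (\<bar>a\<bar> * \<bar>b\<bar>) \<le> a\<^sup>2 + b\<^sup>2" by (simp add: power2_diff)
    moreover have "0 \<le> \<bar>a\<bar> * \<bar>b\<bar>" by simp
    ultimately have "\<bar>a\<bar> * \<bar>b\<bar> \<le> a\<^sup>2 + b\<^sup>2" by linarith
    then show ?thesis by (simp add: abs_mult)
  qed
  then show "AE \<omega> in M. norm (x \<omega> * y \<omega>) \<le> norm ((x \<omega>)\<^sup>2 + (y \<omega>)\<^sup>2)" by simp
qed

lemma square_integrable_combination:
  assumes "square_integrable M x" "square_integrable M y"
  shows "square_integrable M (\<lambda>\<omega>. a * x \<omega> + b * y \<omega>)"
proof -
  have "(\<lambda>\<omega>. (a * x \<omega> + b * y \<omega>)\<^sup>2)
      = (\<lambda>\<omega>. a\<^sup>2 * (x \<omega>)\<^sup>2 + b\<^sup>2 * (y \<omega>)\<^sup>2 + 2 * a * b * (x \<omega> * y \<omega>))"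
    by (auto simp: power2_eq_square algebra_simps)
  moreover have "integrable M (\<lambda>\<omega>. a\<^sup>2 * (x \<omega>)\<^sup>2 + b\<^sup>2 * (y \<omega>)\<^sup>2 + 2 * a * b * (x \<omega> * y \<omega>))"
    using assms square_integrable_mult[OF assms] unfolding square_integrable_def by simp
  moreover have "(\<lambda>\<omega>. a * x \<omega> + b * y \<omega>) \<in> borel_measurable M" using assms by measurable
  ultimately show ?thesis unfolding square_integrable_def by simp
qed

lemma square_integrable_add:
  "square_integrable M x \<Longrightarrow> square_integrable M y \<Longrightarrow> square_integrable M (\<lambda>\<omega>. x \<omega> + y \<omega>)"
  using square_integrable_combination[of M x y 1 1] by simp

lemma square_integrable_diff:
  "square_integrable M x \<Longrightarrow> square_integrable M y \<Longrightarrow> square_integrable M (\<lambda>\<omega>. x \<omega> - y \<omega>)"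
  using square_integrable_combination[of M x y 1 "-1"] by simp

lemma square_integrable_sum:
  assumes "\<And>i. i \<in> F \<Longrightarrow> square_integrable M (x i)"
  shows "square_integrable M (\<lambda>\<omega>. \<Sum>i\<in>F. c i * x i \<omega>)"
  using assms
proof (induction F rule: infinite_finite_induct)
  case (insert i F)
  then have "square_integrable M (\<lambda>\<omega>. c i * x i \<omega> + 1 * (\<Sum>i\<in>F. c i * x i \<omega>))"
    by (intro square_integrable_combination) auto
  with insert.hyps show ?case by simp
qed (auto simp: square_integrable_def)

lemma L2_norm_combination_power2:
  assumes "square_integrable M x" "square_integrable M y"
  shows "(L2_norm M (\<lambda>\<omega>. a * x \<omega> + b * y \<omega>))\<^sup>2
    = a\<^sup>2 * (L2_norm M x)\<^sup>2 + b\<^sup>2 * (L2_norm M y)\<^sup>2 + 2 * a * b * (\<integral>\<omega>. x \<omega> * y \<omega> \<partial>M)"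
proof -
  have "(\<lambda>\<omega>. (a * x \<omega> + b * y \<omega>)\<^sup>2)
      = (\<lambda>\<omega>. a\<^sup>2 * (x \<omega>)\<^sup>2 + b\<^sup>2 * (y \<omega>)\<^sup>2 + 2 * a * b * (x \<omega> * y \<omega>))"
    by (auto simp: power2_eq_square algebra_simps)
  then show ?thesis
    using assms square_integrable_mult[OF assms] unfolding square_integrable_def
    by (simp add: L2_norm_power2)
qed

lemma Cauchy_Schwarz_integral:
  assumes x: "square_integrable M x" and y: "square_integrable M y"
  shows "\<bar>\<integral>\<omega>. x \<omega> * y \<omega> \<partial>M\<bar> \<le> L2_norm M x * L2_norm M y"
proof -
  define A B C where "A = (L2_norm M x)\<^sup>2" and "B = (\<integral>\<omega>. x \<omega> * y \<omega> \<partial>M)" and "C = (L2_norm M y)\<^sup>2"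
  have quad: "0 \<le> a\<^sup>2 * A + b\<^sup>2 * C + 2 * a * b * B" for a b
    using L2_norm_combination_power2[OF x y, of a b] unfolding A_def B_def C_def
    by (metis zero_le_power2)
  have "B\<^sup>2 \<le> A * C"
  proof (cases "A = 0")
    case True
    have "B = 0"
      by (rule linear_coefficient_zero_if_quadratic_nonneg[of C])
         (use quad[of 1] True in \<open>simp add: algebra_simps\<close>)
    then show ?thesis using True by simp
  next
    case False
    then have "A > 0" unfolding A_def by simp
    have "0 \<le> A * (A * C - B\<^sup>2)"
      using quad[of B "- A"] by (simp add: algebra_simps power2_eq_square)
    then show ?thesis using \<open>A > 0\<close> by (simp add: zero_le_mult_iff)
  qed
  then have "\<bar>B\<bar>\<^sup>2 \<le> (L2_norm M x * L2_norm M y)\<^sup>2"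
    unfolding A_def C_def by (simp add: power_mult_distrib)
  then show ?thesis unfolding B_def by (rule power2_le_imp_le) (simp add: L2_norm_nonneg)
qed

lemma L2_norm_combination_le:
  assumes x: "square_integrable M x" and y: "square_integrable M y"
  shows "L2_norm M (\<lambda>\<omega>. a * x \<omega> + b * y \<omega>) \<le> \<bar>a\<bar> * L2_norm M x + \<bar>b\<bar> * L2_norm M y"
proof (rule power2_le_imp_le)
  have "a * b * (\<integral>\<omega>. x \<omega> * y \<omega> \<partial>M) \<le> \<bar>a * b * (\<integral>\<omega>. x \<omega> * y \<omega> \<partial>M)\<bar>" by simp
  also have "\<dots> \<le> \<bar>a\<bar> * \<bar>b\<bar> * (L2_norm M x * L2_norm M y)"
    using Cauchy_Schwarz_integral[OF x y] by (simp add: abs_mult mult_left_mono)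
  finally have *: "a * b * (\<integral>\<omega>. x \<omega> * y \<omega> \<partial>M) \<le> \<bar>a\<bar> * \<bar>b\<bar> * (L2_norm M x * L2_norm M y)" .
  have "(\<bar>a\<bar> * L2_norm M x + \<bar>b\<bar> * L2_norm M y)\<^sup>2
    = a\<^sup>2 * (L2_norm M x)\<^sup>2 + b\<^sup>2 * (L2_norm M y)\<^sup>2 + 2 * (\<bar>a\<bar> * \<bar>b\<bar> * (L2_norm M x * L2_norm M y))"
    by (simp add: power2_sum power_mult_distrib)
  with * show "(L2_norm M (\<lambda>\<omega>. a * x \<omega> + b * y \<omega>))\<^sup>2 \<le> (\<bar>a\<bar> * L2_norm M x + \<bar>b\<bar> * L2_norm M y)\<^sup>2"
    unfolding L2_norm_combination_power2[OF x y] by simp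
qed (simp add: L2_norm_nonneg)

lemma L2_norm_triangle:
  assumes "square_integrable M x" "square_integrable M y" "square_integrable M z"
  shows "L2_norm M (\<lambda>\<omega>. x \<omega> - z \<omega>) \<le> L2_norm M (\<lambda>\<omega>. x \<omega> - y \<omega>) + L2_norm M (\<lambda>\<omega>. y \<omega> - z \<omega>)"
  using L2_norm_combination_le[of M "\<lambda>\<omega>. x \<omega> - y \<omega>" "\<lambda>\<omega>. y \<omega> - z \<omega>" 1 1] assms
  by (simp add: square_integrable_diff)

lemma L2_norm_diff_abs_le:
  assumes "square_integrable M x" "square_integrable M y"
  shows "\<bar>L2_norm M x - L2_norm M y\<bar> \<le> L2_norm M (\<lambda>\<omega>. x \<omega> - y \<omega>)"
  using L2_norm_combination_le[of M "\<lambda>\<omega>. x \<omega> - y \<omega>" y 1 1]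
    L2_norm_combination_le[of M "\<lambda>\<omega>. x \<omega> - y \<omega>" x "-1" 1] assms
  by (simp add: square_integrable_diff abs_le_iff)

context prob_space
begin

lemma square_integrable_imp_integrable: "square_integrable M x \<Longrightarrow> integrable M x"
  using square_integrable_mult[of M x "\<lambda>_. 1"] by (simp add: square_integrable_def)

lemma integral_abs_le_L2_norm:
  assumes "square_integrable M x"
  shows "(\<integral>\<omega>. \<bar>x \<omega>\<bar> \<partial>M) \<le> L2_norm M x"
proof -
  have "square_integrable M (\<lambda>\<omega>. \<bar>x \<omega>\<bar>)" "square_integrable M (\<lambda>_. 1)"
    using assms unfolding square_integrable_def by auto
  from Cauchy_Schwarz_integral[OF this] show ?thesis
    by (simp add: L2_norm_def prob_space)
qed

text \<open>
  The Riesz-Fischer theorem. The limit is taken pointwise along a subsequence whose increments are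
  summable in norm, so that it is measurable for the same sub-$\sigma$-algebra as the sequence, even
  if that $\sigma$-algebra does not contain the null sets.
\<close>

lemma L2_complete:
  assumes F: "subalgebra M F"
    and meas: "\<And>n. Y n \<in> borel_measurable F"
    and sq: "\<And>n. square_integrable M (Y n)"
    and Cauchy: "\<And>e. 0 < e \<Longrightarrow> \<exists>N. \<forall>m\<ge>N. \<forall>n\<ge>N. L2_norm M (\<lambda>\<omega>. Y m \<omega> - Y n \<omega>) < e"
  obtains y where "y \<in> borel_measurable F" "square_integrable M y"
    "(\<lambda>n. L2_norm M (\<lambda>\<omega>. Y n \<omega> - y \<omega>)) \<longlonglongrightarrow> 0"
proof -
  have [measurable]: "Y n \<in> borel_measurable M" for n using sq by (simp add: square_integrable_def)
  have "\<exists>N. \<forall>k. \<forall>m\<ge>N k. \<forall>n\<ge>N k. L2_norm M (\<lambda>\<omega>. Y m \<omega> - Y n \<omega>) < (1/2) ^ k"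
    by (intro choice allI Cauchy) simp
  then obtain N where N: "\<And>k m n. m \<ge> N k \<Longrightarrow> n \<ge> N k \<Longrightarrow> L2_norm M (\<lambda>\<omega>. Y m \<omega> - Y n \<omega>) < (1/2) ^ k"
    by blast
  \<comment> \<open>The additional summand \<open>k\<close> forces \<open>r\<close> to be unbounded.\<close>
  define r where "r k = (\<Sum>i\<le>k. N i) + k" for k
  have r: "N k \<le> r k" "r k \<le> r (Suc k)" "k \<le> r k" for k
    unfolding r_def by (auto intro: member_le_sum trans_le_add1)
  define D where "D k \<omega> = Y (r (Suc k)) \<omega> - Y (r k) \<omega>" for k \<omega>
  have [measurable]: "D k \<in> borel_measurable M" for k unfolding D_def by measurable
  have D_sq: "square_integrable M (D k)" for k
    unfolding D_def by (intro square_integrable_diff sq)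
  have D_le: "(\<integral>\<^sup>+\<omega>. ennreal \<bar>D k \<omega>\<bar> \<partial>M) \<le> ennreal ((1/2) ^ k)" for k
  proof -
    have "(\<integral>\<^sup>+\<omega>. ennreal \<bar>D k \<omega>\<bar> \<partial>M) = ennreal (\<integral>\<omega>. \<bar>D k \<omega>\<bar> \<partial>M)"
      by (intro nn_integral_eq_integral) (auto intro!: integrable_abs simp: square_integrable_imp_integrable[OF D_sq])
    moreover have "(\<integral>\<omega>. \<bar>D k \<omega>\<bar> \<partial>M) \<le> (1/2) ^ k"
      using integral_abs_le_L2_norm[OF D_sq, of k] N[of k "r (Suc k)" "r k"] r[of k]
      unfolding D_def by simp
    ultimately show ?thesis by (simp add: ennreal_leI)
  qed
  have "(\<integral>\<^sup>+\<omega>. (\<Sum>k. ennreal \<bar>D k \<omega>\<bar>) \<partial>M) = (\<Sum>k. \<integral>\<^sup>+\<omega>. ennreal \<bar>D k \<omega>\<bar> \<partial>M)"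
    by (rule nn_integral_suminf) measurable
  also have "\<dots> \<le> (\<Sum>k. ennreal ((1/2) ^ k))" by (intro suminf_le D_le) auto
  also have "\<dots> = ennreal (\<Sum>k. (1/2) ^ k)" by (rule suminf_ennreal2) (auto intro: summable_geometric)
  also have "\<dots> < \<infinity>" by simp
  finally have "AE \<omega> in M. (\<Sum>k. ennreal \<bar>D k \<omega>\<bar>) \<noteq> \<infinity>"
    by (intro nn_integral_PInf_AE) (auto simp: less_top)
  then have conv: "AE \<omega> in M. (\<lambda>k. Y (r k) \<omega>) \<longlonglongrightarrow> lim (\<lambda>k. Y (r k) \<omega>)"
  proof eventually_elim
    case (elim \<omega>)
    then have "summable (\<lambda>k. \<bar>D k \<omega>\<bar>)"
      by (intro summable_suminf_not_top) (auto simp: infinity_ennreal_def)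
    then have "summable (\<lambda>k. D k \<omega>)" by (rule summable_rabs_cancel)
    then have "convergent (\<lambda>n. \<Sum>k<n. D k \<omega>)" by (simp add: summable_iff_convergent)
    then have "convergent (\<lambda>n. (\<Sum>k<n. D k \<omega>) + Y (r 0) \<omega>)"
      by (intro convergent_add convergent_const)
    moreover have "(\<Sum>k<n. D k \<omega>) + Y (r 0) \<omega> = Y (r n) \<omega>" for n
      by (induction n) (auto simp: D_def)
    ultimately show ?case by (simp add: convergent_LIMSEQ_iff)
  qed
  define y where "y \<omega> = lim (\<lambda>k. Y (r k) \<omega>)" for \<omega>
  have yF: "y \<in> borel_measurable F"
    unfolding y_def by (rule borel_measurable_lim_metric) (rule meas)
  then have [measurable]: "y \<in> borel_measurable M" by (rule measurable_from_subalg[OF F])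
  have Fatou: "(\<integral>\<^sup>+\<omega>. ennreal ((Y n \<omega> - y \<omega>)\<^sup>2) \<partial>M) \<le> ennreal (((1/2) ^ j)\<^sup>2)" if "N j \<le> n" for j n
  proof -
    have "(\<integral>\<^sup>+\<omega>. ennreal ((Y n \<omega> - y \<omega>)\<^sup>2) \<partial>M)
        = (\<integral>\<^sup>+\<omega>. liminf (\<lambda>k. ennreal ((Y n \<omega> - Y (r k) \<omega>)\<^sup>2)) \<partial>M)"
    proof (rule nn_integral_cong_AE, use conv in eventually_elim)
      case (elim \<omega>)
      then have "(\<lambda>k. ennreal ((Y n \<omega> - Y (r k) \<omega>)\<^sup>2)) \<longlonglongrightarrow> ennreal ((Y n \<omega> - y \<omega>)\<^sup>2)"
        unfolding y_def by (intro tendsto_ennrealI tendsto_intros)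
      then show ?case by (intro lim_imp_Liminf[symmetric]) simp_all
    qed
    also have "\<dots> \<le> liminf (\<lambda>k. \<integral>\<^sup>+\<omega>. ennreal ((Y n \<omega> - Y (r k) \<omega>)\<^sup>2) \<partial>M)"
      by (rule nn_integral_liminf) measurable
    also have "\<dots> \<le> liminf (\<lambda>k. ennreal (((1/2) ^ j)\<^sup>2))"
    proof (rule Liminf_mono)
      show "\<forall>\<^sub>F k in sequentially. (\<integral>\<^sup>+\<omega>. ennreal ((Y n \<omega> - Y (r k) \<omega>)\<^sup>2) \<partial>M) \<le> ennreal (((1/2) ^ j)\<^sup>2)"
      proof (rule eventually_sequentiallyI[of "N j"])
        fix k assume "N j \<le> k"
        then have "N j \<le> r k" using r(3)[of k] by simp
        have "(\<integral>\<^sup>+\<omega>. ennreal ((Y n \<omega> - Y (r k) \<omega>)\<^sup>2) \<partial>M) = ennreal ((L2_norm M (\<lambda>\<omega>. Y n \<omega> - Y (r k) \<omega>))\<^sup>2)"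
          unfolding L2_norm_power2
          by (rule nn_integral_eq_integral)
             (use square_integrable_diff[OF sq sq] in \<open>auto simp: square_integrable_def\<close>)
        also have "\<dots> \<le> ennreal (((1/2) ^ j)\<^sup>2)"
          using less_imp_le[OF N[OF that \<open>N j \<le> r k\<close>]] L2_norm_nonneg by (intro ennreal_leI power_mono)
        finally show "(\<integral>\<^sup>+\<omega>. ennreal ((Y n \<omega> - Y (r k) \<omega>)\<^sup>2) \<partial>M) \<le> ennreal (((1/2) ^ j)\<^sup>2)" .
      qed
    qed
    also have "\<dots> = ennreal (((1/2) ^ j)\<^sup>2)" by (simp add: Liminf_const)
    finally show ?thesis .
  qed
  have diff_sq: "square_integrable M (\<lambda>\<omega>. Y n \<omega> - y \<omega>)" if "N j \<le> n" for j n
    unfolding square_integrable_def using Fatou[OF that]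
    by (auto intro!: integrableI_bounded simp: less_top[symmetric] top_unique)
  have y_sq: "square_integrable M y"
    using square_integrable_diff[OF sq[of "N 0"] diff_sq[of 0 "N 0"]] by simp
  have "(\<lambda>n. L2_norm M (\<lambda>\<omega>. Y n \<omega> - y \<omega>)) \<longlonglongrightarrow> 0"
  proof (rule LIMSEQ_I)
    fix e :: real assume "0 < e"
    then obtain j where j: "(1/2) ^ j < e" using real_arch_pow_inv[of e "1/2"] by auto
    have "norm (L2_norm M (\<lambda>\<omega>. Y n \<omega> - y \<omega>) - 0) < e" if n: "N j \<le> n" for n
    proof -
      have "(\<integral>\<^sup>+\<omega>. ennreal ((Y n \<omega> - y \<omega>)\<^sup>2) \<partial>M) = ennreal ((L2_norm M (\<lambda>\<omega>. Y n \<omega> - y \<omega>))\<^sup>2)"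
        unfolding L2_norm_power2
        by (rule nn_integral_eq_integral) (use diff_sq[OF n] in \<open>auto simp: square_integrable_def\<close>)
      then have "(L2_norm M (\<lambda>\<omega>. Y n \<omega> - y \<omega>))\<^sup>2 \<le> ((1/2) ^ j)\<^sup>2" using Fatou[OF n] by simp
      then have "L2_norm M (\<lambda>\<omega>. Y n \<omega> - y \<omega>) \<le> (1/2) ^ j" by (rule power2_le_imp_le) simp
      then show ?thesis using j L2_norm_nonneg[of M "\<lambda>\<omega>. Y n \<omega> - y \<omega>"] by simp
    qed
    then show "\<exists>no. \<forall>n\<ge>no. norm (L2_norm M (\<lambda>\<omega>. Y n \<omega> - y \<omega>) - 0) < e" by blast
  qed
  with yF y_sq show thesis by (rule that)
qed

end

section \<open>Signed weights with vanishing Laplace or Fourier transform\<close>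

lemma exp_minus_one_bound: "\<bar>exp u - 1\<bar> \<le> \<bar>u\<bar> * exp \<bar>u\<bar>" for u :: real
proof (cases "u \<ge> 0")
  case True
  have "1 - u \<le> exp (- u)" using exp_ge_add_one_self[of "-u"] by simp
  then have "(1 - u) * exp u \<le> exp (- u) * exp u" by (intro mult_right_mono) auto
  then show ?thesis using True by (simp add: exp_minus algebra_simps)
next
  case False
  have "1 - exp u \<le> - u" using exp_ge_add_one_self[of u] by linarith
  also have "\<dots> \<le> - u * exp (- u)" using False by (simp add: mult_le_cancel_left1)
  finally show ?thesis using False by simp
qed

lemma abs_le_exp_abs: "\<bar>u\<bar> \<le> exp \<bar>u\<bar>" for u :: real
  using exp_ge_add_one_self[of "\<bar>u\<bar>"] by linarith

text \<open>
  Absolute convergence, for every exponent, of the Laplace transform of \<open>Y\<close> under the signed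
  measure with density \<open>\<xi>\<close>.
\<close>

definition all_exp_moments :: "'a measure \<Rightarrow> ('a \<Rightarrow> real) \<Rightarrow> ('a \<Rightarrow> real) \<Rightarrow> bool" where
  "all_exp_moments M Y \<xi> \<longleftrightarrow> \<xi> \<in> borel_measurable M \<and> Y \<in> borel_measurable M \<and>
     (\<forall>c. integrable M (\<lambda>\<omega>. \<xi> \<omega> * exp (c * \<bar>Y \<omega>\<bar>)))"

lemma all_exp_momentsD:
  assumes "all_exp_moments M Y \<xi>"
  shows "\<xi> \<in> borel_measurable M" "Y \<in> borel_measurable M" "integrable M (\<lambda>\<omega>. \<xi> \<omega> * exp (c * \<bar>Y \<omega>\<bar>))"
  using assms by (auto simp: all_exp_moments_def)

lemma all_exp_moments_exp_mult:
  assumes "all_exp_moments M Y \<xi>"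
  shows "all_exp_moments M Y (\<lambda>\<omega>. \<xi> \<omega> * exp (t * Y \<omega>))"
proof -
  note [measurable] = all_exp_momentsD(1,2)[OF assms]
  have "integrable M (\<lambda>\<omega>. (\<xi> \<omega> * exp (t * Y \<omega>)) * exp (c * \<bar>Y \<omega>\<bar>))" for c
  proof (rule Bochner_Integration.integrable_bound[OF all_exp_momentsD(3)[OF assms, of "\<bar>t\<bar> + c"]])
    have "t * y \<le> \<bar>t\<bar> * \<bar>y\<bar>" for y using abs_ge_self[of "t * y"] by (simp only: abs_mult)
    then have "exp (t * y + c * \<bar>y\<bar>) \<le> exp ((\<bar>t\<bar> + c) * \<bar>y\<bar>)" for y
      by (simp add: distrib_right)
    then show "AE \<omega> in M. norm (\<xi> \<omega> * exp (t * Y \<omega>) * exp (c * \<bar>Y \<omega>\<bar>))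
        \<le> norm (\<xi> \<omega> * exp ((\<bar>t\<bar> + c) * \<bar>Y \<omega>\<bar>))"
      by (intro AE_I2) (simp add: abs_mult mult.assoc exp_add[symmetric] mult_left_mono)
  qed measurable
  then show ?thesis unfolding all_exp_moments_def by simp
qed

lemma all_exp_moments_mult:
  assumes "all_exp_moments M Y \<xi>"
  shows "all_exp_moments M Y (\<lambda>\<omega>. \<xi> \<omega> * Y \<omega>)"
proof -
  note [measurable] = all_exp_momentsD(1,2)[OF assms]
  have "integrable M (\<lambda>\<omega>. (\<xi> \<omega> * Y \<omega>) * exp (c * \<bar>Y \<omega>\<bar>))" for c
  proof (rule Bochner_Integration.integrable_bound[OF all_exp_momentsD(3)[OF assms, of "1 + c"]])
    have "\<bar>y\<bar> * exp (c * \<bar>y\<bar>) \<le> exp \<bar>y\<bar> * exp (c * \<bar>y\<bar>)" for y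
      using abs_le_exp_abs by (intro mult_right_mono) auto
    then show "AE \<omega> in M. norm (\<xi> \<omega> * Y \<omega> * exp (c * \<bar>Y \<omega>\<bar>)) \<le> norm (\<xi> \<omega> * exp ((1 + c) * \<bar>Y \<omega>\<bar>))"
      by (intro AE_I2) (simp add: abs_mult mult.assoc exp_add[symmetric] distrib_right mult_left_mono)
  qed measurable
  then show ?thesis unfolding all_exp_moments_def by simp
qed

text \<open>
  Difference quotients $(e^{hY} - 1)/h$ with $|h| \le 1$ are bounded by $e^{2|Y|}$, which permits
  differentiation under the integral sign.
\<close>

lemma has_derivative_exp_integral_at_0:
  assumes "all_exp_moments M Y \<xi>"
  shows "((\<lambda>t. \<integral>\<omega>. \<xi> \<omega> * exp (t * Y \<omega>) \<partial>M) has_real_derivative (\<integral>\<omega>. \<xi> \<omega> * Y \<omega> \<partial>M)) (at 0)"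
proof -
  note [measurable] = all_exp_momentsD(1,2)[OF assms]
  note mom = all_exp_momentsD(3)[OF assms]
  have int: "integrable M (\<lambda>\<omega>. \<xi> \<omega> * exp (t * Y \<omega>))" for t
    using all_exp_momentsD(3)[OF all_exp_moments_exp_mult[OF assms], of t 0] by simp
  have bound: "\<bar>(exp (h * y) - 1) / h\<bar> \<le> exp (2 * \<bar>y\<bar>)" if "h \<noteq> 0" "\<bar>h\<bar> \<le> 1" for h y :: real
  proof -
    have "\<bar>exp (h * y) - 1\<bar> \<le> \<bar>h\<bar> * \<bar>y\<bar> * exp (\<bar>h\<bar> * \<bar>y\<bar>)"
      using exp_minus_one_bound[of "h * y"] by (simp add: abs_mult)
    also have "\<dots> \<le> \<bar>h\<bar> * (exp \<bar>y\<bar> * exp \<bar>y\<bar>)"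
      using that abs_le_exp_abs[of y] unfolding mult.assoc
      by (intro mult_left_mono mult_mono) (auto simp: mult_left_le_one_le)
    also have "exp \<bar>y\<bar> * exp \<bar>y\<bar> = exp (2 * \<bar>y\<bar>)" by (simp add: exp_add[symmetric])
    finally show ?thesis using that by (simp add: abs_divide divide_le_eq mult.commute)
  qed
  have "((\<lambda>h. \<integral>\<omega>. \<xi> \<omega> * ((exp (h * Y \<omega>) - 1) / h) \<partial>M) \<longlongrightarrow> (\<integral>\<omega>. \<xi> \<omega> * Y \<omega> \<partial>M)) (at 0)"
    unfolding tendsto_at_iff_sequentially comp_def
  proof (intro allI impI)
    fix x :: "nat \<Rightarrow> real"
    assume nz: "\<forall>i. x i \<in> UNIV - {0}" and lim: "x \<longlonglongrightarrow> 0"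
    then obtain N where N: "\<And>n. n \<ge> N \<Longrightarrow> \<bar>x n\<bar> \<le> 1"
      using LIMSEQ_D[OF lim, of 1] by (auto intro: less_imp_le)
    have "(\<lambda>n. \<integral>\<omega>. \<xi> \<omega> * ((exp (x (n + N) * Y \<omega>) - 1) / x (n + N)) \<partial>M) \<longlonglongrightarrow> (\<integral>\<omega>. \<xi> \<omega> * Y \<omega> \<partial>M)"
    proof (rule integral_dominated_convergence[where w="\<lambda>\<omega>. \<bar>\<xi> \<omega> * exp (2 * \<bar>Y \<omega>\<bar>)\<bar>"])
      show "AE \<omega> in M. (\<lambda>n. \<xi> \<omega> * ((exp (x (n + N) * Y \<omega>) - 1) / x (n + N))) \<longlonglongrightarrow> \<xi> \<omega> * Y \<omega>"
      proof (intro AE_I2 tendsto_intros)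
        fix \<omega>
        have "((\<lambda>h. exp (h * Y \<omega>)) has_real_derivative Y \<omega>) (at 0)"
          by (auto intro!: derivative_eq_intros)
        then have "((\<lambda>h. (exp (h * Y \<omega>) - 1) / h) \<longlongrightarrow> Y \<omega>) (at 0)"
          by (simp add: DERIV_def)
        then have "(\<lambda>n. (exp (x n * Y \<omega>) - 1) / x n) \<longlonglongrightarrow> Y \<omega>"
          using nz lim unfolding tendsto_at_iff_sequentially comp_def by auto
        then show "(\<lambda>n. (exp (x (n + N) * Y \<omega>) - 1) / x (n + N)) \<longlonglongrightarrow> Y \<omega>"
          by (rule LIMSEQ_ignore_initial_segment)
      qed
      show "AE \<omega> in M. norm (\<xi> \<omega> * ((exp (x (n + N) * Y \<omega>) - 1) / x (n + N))) \<le> \<bar>\<xi> \<omega> * exp (2 * \<bar>Y \<omega>\<bar>)\<bar>" for n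
        using bound[of "x (n + N)"] nz N[of "n + N"]
        by (intro AE_I2) (simp only: real_norm_def abs_mult abs_exp_cancel, intro mult_left_mono, auto)
      show "integrable M (\<lambda>\<omega>. \<bar>\<xi> \<omega> * exp (2 * \<bar>Y \<omega>\<bar>)\<bar>)" by (intro integrable_abs mom)
    qed measurable
    then show "(\<lambda>n. \<integral>\<omega>. \<xi> \<omega> * ((exp (x n * Y \<omega>) - 1) / x n) \<partial>M) \<longlonglongrightarrow> (\<integral>\<omega>. \<xi> \<omega> * Y \<omega> \<partial>M)"
      by (rule LIMSEQ_offset)
  qed
  moreover have "(\<integral>\<omega>. \<xi> \<omega> * ((exp (h * Y \<omega>) - 1) / h) \<partial>M)
      = ((\<integral>\<omega>. \<xi> \<omega> * exp ((0 + h) * Y \<omega>) \<partial>M) - (\<integral>\<omega>. \<xi> \<omega> * exp (0 * Y \<omega>) \<partial>M)) / h" for h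
  proof -
    have "(\<integral>\<omega>. \<xi> \<omega> * ((exp (h * Y \<omega>) - 1) / h) \<partial>M) = (\<integral>\<omega>. (\<xi> \<omega> * exp (h * Y \<omega>) - \<xi> \<omega> * exp (0 * Y \<omega>)) / h \<partial>M)"
      by (intro Bochner_Integration.integral_cong) (auto simp: algebra_simps diff_divide_distrib)
    also have "\<dots> = ((\<integral>\<omega>. \<xi> \<omega> * exp ((0 + h) * Y \<omega>) \<partial>M) - (\<integral>\<omega>. \<xi> \<omega> * exp (0 * Y \<omega>) \<partial>M)) / h"
      using int[of h] int[of 0] by simp
    finally show ?thesis .
  qed
  ultimately show ?thesis unfolding DERIV_def by (simp only: )
qed

text \<open>
  Each differentiation of the Laplace transform multiplies the weight by \<open>Y\<close>, and the hypotheses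
  pass from \<open>\<xi>\<close> to \<open>\<xi> Y\<close>.
\<close>

lemma moments_zero_if_laplace_zero:
  assumes "all_exp_moments M Y \<xi>"
    and "\<And>t. (\<integral>\<omega>. \<xi> \<omega> * exp (t * Y \<omega>) \<partial>M) = 0"
  shows "(\<integral>\<omega>. \<xi> \<omega> * Y \<omega> ^ k \<partial>M) = 0"
  using assms
proof (induction k arbitrary: \<xi>)
  case 0
  from 0(2)[of 0] show ?case by simp
next
  case (Suc k)
  have "(\<integral>\<omega>. (\<xi> \<omega> * Y \<omega>) * exp (t * Y \<omega>) \<partial>M) = 0" for t
  proof -
    have "((\<lambda>s. \<integral>\<omega>. \<xi> \<omega> * exp (t * Y \<omega>) * exp (s * Y \<omega>) \<partial>M)
        has_real_derivative (\<integral>\<omega>. \<xi> \<omega> * exp (t * Y \<omega>) * Y \<omega> \<partial>M)) (at 0)"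
      by (rule has_derivative_exp_integral_at_0) (rule all_exp_moments_exp_mult[OF Suc.prems(1)])
    moreover have "(\<integral>\<omega>. \<xi> \<omega> * exp (t * Y \<omega>) * exp (s * Y \<omega>) \<partial>M) = 0" for s
      using Suc.prems(2)[of "t + s"] by (simp add: mult.assoc exp_add distrib_right)
    ultimately have "(\<integral>\<omega>. \<xi> \<omega> * exp (t * Y \<omega>) * Y \<omega> \<partial>M) = 0"
      using DERIV_unique[OF _ DERIV_const] by simp
    then show ?thesis by (simp add: ac_simps)
  qed
  from Suc.IH[OF all_exp_moments_mult[OF Suc.prems(1)] this] show ?case by (simp add: ac_simps)
qed

text \<open>
  All moments vanish, and the exponential series of $e^{iY}$ may be integrated term by term since
  its partial sums are dominated by $e^{|Y|}$.
\<close>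

lemma fourier_zero_if_laplace_zero:
  assumes "all_exp_moments M Y \<xi>"
    and "\<And>t. (\<integral>\<omega>. \<xi> \<omega> * exp (t * Y \<omega>) \<partial>M) = 0"
  shows "(CLINT \<omega>|M. of_real (\<xi> \<omega>) * iexp (Y \<omega>)) = 0"
proof -
  note [measurable] = all_exp_momentsD(1,2)[OF assms(1)]
  let ?s = "\<lambda>n \<omega>. \<Sum>k<n. of_real (\<xi> \<omega>) * ((\<i> * of_real (Y \<omega>)) ^ k /\<^sub>R fact k)"
  have exp_partial: "(\<Sum>k<n. \<bar>y\<bar> ^ k / fact k) \<le> exp \<bar>y\<bar>" for n and y :: real
  proof -
    have "(\<lambda>k. \<bar>y\<bar> ^ k / fact k) sums exp \<bar>y\<bar>"
      using exp_converges[of "\<bar>y\<bar>"] by (simp add: divide_inverse mult.commute)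
    from sum_le_suminf[OF sums_summable[OF this], of "{..<n}"] sums_unique[OF this]
    show ?thesis by simp
  qed
  have "(\<lambda>n. CLINT \<omega>|M. ?s n \<omega>) \<longlonglongrightarrow> (CLINT \<omega>|M. of_real (\<xi> \<omega>) * iexp (Y \<omega>))"
  proof (rule integral_dominated_convergence[where w="\<lambda>\<omega>. \<bar>\<xi> \<omega> * exp (1 * \<bar>Y \<omega>\<bar>)\<bar>"])
    show "AE \<omega> in M. (\<lambda>n. ?s n \<omega>) \<longlonglongrightarrow> of_real (\<xi> \<omega>) * iexp (Y \<omega>)"
    proof (intro AE_I2)
      fix \<omega>
      have "(\<lambda>k. of_real (\<xi> \<omega>) * ((\<i> * of_real (Y \<omega>)) ^ k /\<^sub>R fact k)) sums (of_real (\<xi> \<omega>) * iexp (Y \<omega>))"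
        by (intro sums_mult exp_converges)
      then show "(\<lambda>n. ?s n \<omega>) \<longlonglongrightarrow> of_real (\<xi> \<omega>) * iexp (Y \<omega>)" by (simp add: sums_def)
    qed
    show "AE \<omega> in M. norm (?s n \<omega>) \<le> \<bar>\<xi> \<omega> * exp (1 * \<bar>Y \<omega>\<bar>)\<bar>" for n
    proof (intro AE_I2)
      fix \<omega>
      have "norm (?s n \<omega>) \<le> (\<Sum>k<n. norm (of_real (\<xi> \<omega>) * ((\<i> * of_real (Y \<omega>)) ^ k /\<^sub>R fact k)))"
        by (rule norm_sum)
      also have "\<dots> = \<bar>\<xi> \<omega>\<bar> * (\<Sum>k<n. \<bar>Y \<omega>\<bar> ^ k / fact k)"
        by (simp add: norm_mult norm_power sum_distrib_left divide_inverse mult_ac)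
      also have "\<dots> \<le> \<bar>\<xi> \<omega>\<bar> * exp \<bar>Y \<omega>\<bar>" by (intro mult_left_mono exp_partial) auto
      finally show "norm (?s n \<omega>) \<le> \<bar>\<xi> \<omega> * exp (1 * \<bar>Y \<omega>\<bar>)\<bar>" by (simp add: abs_mult)
    qed
    show "integrable M (\<lambda>\<omega>. \<bar>\<xi> \<omega> * exp (1 * \<bar>Y \<omega>\<bar>)\<bar>)"
      by (intro integrable_abs all_exp_momentsD(3)[OF assms(1)])
  qed measurable
  moreover have "(CLINT \<omega>|M. ?s n \<omega>) = 0" for n
  proof -
    have mom: "all_exp_moments M Y (\<lambda>\<omega>. \<xi> \<omega> * Y \<omega> ^ k)" for k
    proof (induction k)
      case 0 then show ?case using assms(1) by simp
    next
      case (Suc k)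
      from all_exp_moments_mult[OF this] show ?case by (simp add: ac_simps)
    qed
    have int: "integrable M (\<lambda>\<omega>. \<xi> \<omega> * Y \<omega> ^ k)" for k
      using all_exp_momentsD(3)[OF mom[of k], of 0] by simp
    have "?s n \<omega> = (\<Sum>k<n. (\<i> ^ k /\<^sub>R fact k) * of_real (\<xi> \<omega> * Y \<omega> ^ k))" for \<omega>
      by (intro sum.cong refl) (simp add: power_mult_distrib scaleR_conv_of_real)
    then have "(CLINT \<omega>|M. ?s n \<omega>) = (\<Sum>k<n. (\<i> ^ k /\<^sub>R fact k) * (CLINT \<omega>|M. of_real (\<xi> \<omega> * Y \<omega> ^ k)))"
      by (simp only: integral_mult_right_zero Bochner_Integration.integral_sum
          integrable_mult_right integrable_of_real int)
    also have "\<dots> = 0"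
      by (simp only: integral_complex_of_real moments_zero_if_laplace_zero[OF assms]) simp
    finally show ?thesis .
  qed
  ultimately show ?thesis using LIMSEQ_unique[OF _ tendsto_const] by fastforce
qed

text \<open>
  The positive and the negative part of \<open>\<xi>\<close>, both normalised to mass $1$, give \<open>Y\<close> two laws with the
  same characteristic function, and Levy's uniqueness theorem identifies them.
\<close>

lemma (in prob_space) weighted_law_zero_if_fourier_zero:
  assumes \<xi>: "integrable M \<xi>" and [measurable]: "Y \<in> borel_measurable M"
    and fourier: "\<And>t. (CLINT \<omega>|M. of_real (\<xi> \<omega>) * iexp (t * Y \<omega>)) = 0"
    and B [measurable]: "B \<in> sets borel"
  shows "(\<integral>\<omega>. \<xi> \<omega> * indicator B (Y \<omega>) \<partial>M) = 0"
proof -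
  have [measurable]: "\<xi> \<in> borel_measurable M" using \<xi> by simp
  define p where "p \<omega> = max 0 (\<xi> \<omega>)" for \<omega>
  define q where "q \<omega> = max 0 (- \<xi> \<omega>)" for \<omega>
  have [measurable]: "p \<in> borel_measurable M" "q \<in> borel_measurable M"
    unfolding p_def q_def by measurable
  have pq: "\<xi> \<omega> = p \<omega> - q \<omega>" "0 \<le> p \<omega>" "0 \<le> q \<omega>" for \<omega> unfolding p_def q_def by auto
  have int: "integrable M p" "integrable M q" unfolding p_def q_def using \<xi> by auto
  have intc: "integrable M (\<lambda>\<omega>. of_real (w \<omega>) * iexp (t * Y \<omega>))" if "integrable M w" for w t
    by (rule Bochner_Integration.integrable_bound[OF that]) (use that in \<open>auto simp: norm_mult\<close>)
  have eq: "(CLINT \<omega>|M. of_real (p \<omega>) * iexp (t * Y \<omega>)) = (CLINT \<omega>|M. of_real (q \<omega>) * iexp (t * Y \<omega>))" for t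
    using fourier[of t] intc[OF int(1), of t] intc[OF int(2), of t]
    by (simp add: pq(1) left_diff_distrib)
  define m where "m = (\<integral>\<omega>. p \<omega> \<partial>M)"
  have "complex_of_real (\<integral>\<omega>. p \<omega> \<partial>M) = complex_of_real (\<integral>\<omega>. q \<omega> \<partial>M)" using eq[of 0] by simp
  then have m: "(\<integral>\<omega>. q \<omega> \<partial>M) = m" unfolding m_def by simp
  have intB: "integrable M (\<lambda>\<omega>. w \<omega> * indicator B (Y \<omega>))" if "integrable M w" for w :: "'a \<Rightarrow> real"
    by (rule Bochner_Integration.integrable_bound[OF that])
       (use that in \<open>auto simp: indicator_def\<close>)
  have split: "(\<integral>\<omega>. \<xi> \<omega> * indicator B (Y \<omega>) \<partial>M)
      = (\<integral>\<omega>. p \<omega> * indicator B (Y \<omega>) \<partial>M) - (\<integral>\<omega>. q \<omega> * indicator B (Y \<omega>) \<partial>M)"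
    using intB[OF int(1)] intB[OF int(2)] by (simp add: pq(1) left_diff_distrib)
  show ?thesis
  proof (cases "m = 0")
    case True
    have "AE \<omega> in M. p \<omega> = 0" "AE \<omega> in M. q \<omega> = 0"
      using True m integral_nonneg_eq_0_iff_AE[OF int(1)] integral_nonneg_eq_0_iff_AE[OF int(2)] pq
      by (auto simp: m_def)
    then have "AE \<omega> in M. \<xi> \<omega> * indicator B (Y \<omega>) = 0" by eventually_elim (simp add: pq(1))
    then show ?thesis by (rule integral_eq_zero_AE)
  next
    case False
    moreover have "m \<ge> 0" unfolding m_def using pq by simp
    ultimately have "m > 0" by simp
    define D where "D w = distr (density M (\<lambda>\<omega>. ennreal (w \<omega> / m))) borel Y" for w
    have D: "real_distribution (D w)"
        "char (D w) t = (CLINT \<omega>|M. of_real (w \<omega>) * iexp (t * Y \<omega>)) / of_real m"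
        "measure (D w) B = (\<integral>\<omega>. w \<omega> * indicator B (Y \<omega>) \<partial>M) / m"
      if w: "integrable M w" "\<And>\<omega>. 0 \<le> w \<omega>" "(\<integral>\<omega>. w \<omega> \<partial>M) = m" for w t
    proof -
      have [measurable]: "w \<in> borel_measurable M" using w by simp
      have nn: "AE \<omega> in M. 0 \<le> w \<omega> / m" using w \<open>m > 0\<close> by simp
      have "emeasure (density M (\<lambda>\<omega>. ennreal (w \<omega> / m))) (space M) = ennreal (\<integral>\<omega>. w \<omega> / m \<partial>M)"
        using w nn by (subst emeasure_density)
          (auto simp: nn_integral_eq_integral intro!: nn_integral_cong nn_integral_eq_integral)
      then have "prob_space (density M (\<lambda>\<omega>. ennreal (w \<omega> / m)))"
        using w \<open>m > 0\<close> by (intro prob_spaceI) simp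
      then interpret P: prob_space "density M (\<lambda>\<omega>. ennreal (w \<omega> / m))" .
      show "real_distribution (D w)" unfolding D_def by (rule P.real_distribution_distr) simp
      have "char (D w) t = (CLINT \<omega>|M. (w \<omega> / m) *\<^sub>R iexp (t * Y \<omega>))"
        unfolding D_def char_def by (subst integral_distr) (auto simp: integral_density nn)
      also have "\<dots> = (CLINT \<omega>|M. (of_real (w \<omega>) * iexp (t * Y \<omega>)) / of_real m)"
        by (intro Bochner_Integration.integral_cong) (auto simp: scaleR_conv_of_real)
      also have "\<dots> = (CLINT \<omega>|M. of_real (w \<omega>) * iexp (t * Y \<omega>)) / of_real m"
        by simp
      finally show "char (D w) t = (CLINT \<omega>|M. of_real (w \<omega>) * iexp (t * Y \<omega>)) / of_real m" .
      have "measure (D w) B = (\<integral>x. indicator B x \<partial>D w)" by (simp add: D_def)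
      also have "\<dots> = (\<integral>\<omega>. (w \<omega> / m) *\<^sub>R indicator B (Y \<omega>) \<partial>M)"
        unfolding D_def by (subst integral_distr) (auto simp: integral_density nn)
      also have "\<dots> = (\<integral>\<omega>. w \<omega> * indicator B (Y \<omega>) / m \<partial>M)" by simp
      also have "\<dots> = (\<integral>\<omega>. w \<omega> * indicator B (Y \<omega>) \<partial>M) / m" by (rule integral_divide_zero)
      finally show "measure (D w) B = (\<integral>\<omega>. w \<omega> * indicator B (Y \<omega>) \<partial>M) / m" .
    qed
    note Dp = D[OF int(1) pq(2) m_def[symmetric]] and Dq = D[OF int(2) pq(3) m]
    have "D p = D q"
      by (rule Levy_uniqueness[OF Dp(1) Dq(1)]) (simp only: fun_eq_iff Dp(2) Dq(2) eq simp_thms)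
    then show ?thesis using Dp(3) Dq(3) \<open>m > 0\<close> by (simp add: split)
  qed
qed

section \<open>Isonormal Gaussian families\<close>

lemma distr_scaled_std_normal:
  assumes "\<sigma> > 0"
  shows "distr std_normal_distribution borel (\<lambda>x. \<sigma> * x)
    = density lborel (\<lambda>x. ennreal (normal_density 0 \<sigma> x))"
proof -
  interpret S: prob_space std_normal_distribution by (rule prob_space_normal_density) simp
  have "distributed std_normal_distribution lborel (\<lambda>x. x) std_normal_density"
    unfolding distributed_def by (simp add: distr_id2)
  from S.normal_density_affine[OF this, of \<sigma> 0] assms
  have "distr std_normal_distribution lborel (\<lambda>x. \<sigma> * x)
      = density lborel (\<lambda>x. ennreal (normal_density 0 \<sigma> x))"
    by (simp add: distributed_def)
  moreover have "distr std_normal_distribution lborel (\<lambda>x. \<sigma> * x)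
      = distr std_normal_distribution borel (\<lambda>x. \<sigma> * x)"
    by (rule distr_cong) auto
  ultimately show ?thesis by simp
qed

lemma char_normal_density:
  assumes "\<sigma> > 0"
  shows "char (density lborel (\<lambda>x. ennreal (normal_density 0 \<sigma> x))) t = of_real (exp (- (t * \<sigma>)\<^sup>2 / 2))"
proof -
  have "char (density lborel (\<lambda>x. ennreal (normal_density 0 \<sigma> x))) t = char std_normal_distribution (t * \<sigma>)"
    unfolding distr_scaled_std_normal[OF assms, symmetric] char_def
    by (subst integral_distr) (auto simp: mult.assoc)
  then show ?thesis by (simp add: char_std_normal_distribution)
qed

text \<open>
  Only one-dimensional laws are prescribed. Since \<open>W\<close> is linear up to null sets, the laws of all
  linear combinations are known as well, so the family is jointly Gaussian with covariance given by
  the inner product.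
\<close>

locale isonormal_family = prob_space M for M :: "'a measure" +
  fixes W :: "'h::real_inner \<Rightarrow> 'a \<Rightarrow> real"
  assumes W_measurable [measurable]: "W f \<in> borel_measurable M"
    and W_linear: "AE \<omega> in M. W (a *\<^sub>R f + b *\<^sub>R g) \<omega> = a * W f \<omega> + b * W g \<omega>"
    and W_char: "char (distr M borel (W f)) t = of_real (exp (- (t * norm f)\<^sup>2 / 2))"
begin

lemma W_scale: "AE \<omega> in M. W (a *\<^sub>R f) \<omega> = a * W f \<omega>"
  using W_linear[of a f 0 f] by simp

lemma W_zero: "AE \<omega> in M. W 0 \<omega> = 0"
  using W_scale[of 0 0] by simp

lemma W_distributed:
  assumes "f \<noteq> 0"
  shows "distributed M lborel (W f) (\<lambda>x. ennreal (normal_density 0 (norm f) x))"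
proof -
  have pos: "0 < norm f" using assms by simp
  interpret D: prob_space "density lborel (\<lambda>x. ennreal (normal_density 0 (norm f) x))"
    by (rule prob_space_normal_density[OF pos])
  have "distr M borel (W f) = density lborel (\<lambda>x. ennreal (normal_density 0 (norm f) x))"
  proof (rule Levy_uniqueness)
    show "real_distribution (distr M borel (W f))" by (rule real_distribution_distr) simp
    show "real_distribution (density lborel (\<lambda>x. ennreal (normal_density 0 (norm f) x)))"
      by unfold_locales auto
  qed (simp add: fun_eq_iff W_char char_normal_density[OF pos])
  moreover have "distr M lborel (W f) = distr M borel (W f)" by (rule distr_cong) auto
  ultimately show ?thesis unfolding distributed_def by simp
qed

lemma exp_W_bochner: "has_bochner_integral M (\<lambda>\<omega>. exp (W f \<omega>)) (exp ((norm f)\<^sup>2 / 2))"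
proof (cases "f = 0")
  case True
  have "has_bochner_integral M (\<lambda>\<omega>. 1) (1::real)"
    by (simp add: has_bochner_integral_iff prob_space)
  moreover have "AE \<omega> in M. exp (W f \<omega>) = 1" using W_zero True by (auto elim: eventually_mono)
  ultimately show ?thesis using True
    by (subst has_bochner_integral_cong_AE[where g = "\<lambda>_. 1"]) auto
next
  case False
  define \<sigma> where "\<sigma> = norm f"
  have \<sigma>: "\<sigma> > 0" using False by (simp add: \<sigma>_def)
  note dist = W_distributed[OF False, folded \<sigma>_def]
  \<comment> \<open>Completing the square: an exponential tilt shifts the mean of a normal density.\<close>
  have shift: "normal_density 0 \<sigma> x * exp x = exp (\<sigma>\<^sup>2 / 2) * normal_density (\<sigma>\<^sup>2) \<sigma> x" for x
  proof -
    have "- (x - 0)\<^sup>2 / (2 * \<sigma>\<^sup>2) + x = \<sigma>\<^sup>2 / 2 + (- (x - \<sigma>\<^sup>2)\<^sup>2 / (2 * \<sigma>\<^sup>2))"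
      using \<sigma> by (simp add: field_simps power2_eq_square)
    then have "exp (- (x - 0)\<^sup>2 / (2 * \<sigma>\<^sup>2)) * exp x = exp (\<sigma>\<^sup>2 / 2) * exp (- (x - \<sigma>\<^sup>2)\<^sup>2 / (2 * \<sigma>\<^sup>2))"
      by (simp only: exp_add[symmetric])
    then show ?thesis unfolding normal_density_def by (simp only: mult.assoc mult.left_commute)
  qed
  have "integrable lborel (\<lambda>x. normal_density 0 \<sigma> x * exp x)"
    unfolding shift using \<sigma> by simp
  then have "integrable M (\<lambda>\<omega>. exp (W f \<omega>))"
    by (subst (asm) distributed_integrable[OF dist]) auto
  moreover have "(\<integral>x. normal_density 0 \<sigma> x * exp x \<partial>lborel) = exp (\<sigma>\<^sup>2 / 2)"
    unfolding shift using \<sigma> by simp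
  then have "(\<integral>\<omega>. exp (W f \<omega>) \<partial>M) = exp (\<sigma>\<^sup>2 / 2)"
    by (subst (asm) distributed_integral[OF dist]) auto
  ultimately show ?thesis by (simp add: has_bochner_integral_iff \<sigma>_def)
qed

lemma integrable_exp_W: "integrable M (\<lambda>\<omega>. exp (W f \<omega>))"
  and integral_exp_W: "(\<integral>\<omega>. exp (W f \<omega>) \<partial>M) = exp ((norm f)\<^sup>2 / 2)"
  using exp_W_bochner by (auto simp: has_bochner_integral_iff)

lemma square_integrable_exp_W: "square_integrable M (\<lambda>\<omega>. exp (W f \<omega>))"
proof -
  have "integrable M (\<lambda>\<omega>. (exp (W f \<omega>))\<^sup>2)"
  proof (subst integrable_cong_AE)
    show "AE \<omega> in M. (exp (W f \<omega>))\<^sup>2 = exp (W (2 *\<^sub>R f) \<omega>)"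
      using W_scale[of 2 f] by eventually_elim (simp add: exp_double)
  qed (auto intro: integrable_exp_W)
  then show ?thesis unfolding square_integrable_def by simp
qed

lemma square_integrable_exp_abs_W: "square_integrable M (\<lambda>\<omega>. exp (c * \<bar>W f \<omega>\<bar>))"
proof -
  have dom: "square_integrable M (\<lambda>\<omega>. exp (W (c *\<^sub>R f) \<omega>) + exp (W ((- c) *\<^sub>R f) \<omega>))"
    by (intro square_integrable_add square_integrable_exp_W)
  have "integrable M (\<lambda>\<omega>. (exp (c * \<bar>W f \<omega>\<bar>))\<^sup>2)"
  proof (rule Bochner_Integration.integrable_bound)
    show "integrable M (\<lambda>\<omega>. (exp (W (c *\<^sub>R f) \<omega>) + exp (W ((- c) *\<^sub>R f) \<omega>))\<^sup>2)"
      using dom by (simp add: square_integrable_def)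
    show "AE \<omega> in M. norm ((exp (c * \<bar>W f \<omega>\<bar>))\<^sup>2)
        \<le> norm ((exp (W (c *\<^sub>R f) \<omega>) + exp (W ((- c) *\<^sub>R f) \<omega>))\<^sup>2)"
      using W_scale[of c f] W_scale[of "- c" f]
      by eventually_elim (auto intro!: power_mono simp: abs_if add_increasing add_increasing2)
  qed measurable
  then show ?thesis unfolding square_integrable_def by simp
qed

lemma all_exp_moments_W:
  assumes "square_integrable M \<xi>"
  shows "all_exp_moments M (W f) \<xi>"
  using square_integrable_mult[OF assms square_integrable_exp_abs_W] assms
  unfolding all_exp_moments_def square_integrable_def by simp

lemma exp_W_add_scaled:
  "(\<integral>\<omega>. \<xi> \<omega> * exp (W f \<omega>) * exp (t * W g \<omega>) \<partial>M) = (\<integral>\<omega>. \<xi> \<omega> * exp (W (f + t *\<^sub>R g) \<omega>) \<partial>M)"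
  if [measurable]: "\<xi> \<in> borel_measurable M"
proof (rule integral_cong_AE)
  show "AE \<omega> in M. \<xi> \<omega> * exp (W f \<omega>) * exp (t * W g \<omega>) = \<xi> \<omega> * exp (W (f + t *\<^sub>R g) \<omega>)"
    using W_linear[of 1 f t g] by eventually_elim (simp add: exp_add)
qed measurable

text \<open>
  Differentiate $t \mapsto E[e^{W(f + t g)}] = e^{\|f + t g\|^2/2}$ at $t = 0$.
\<close>

lemma integral_W_exp_W: "(\<integral>\<omega>. W g \<omega> * exp (W f \<omega>) \<partial>M) = (g \<bullet> f) * exp ((norm f)\<^sup>2 / 2)"
proof -
  have "((\<lambda>t. \<integral>\<omega>. exp (W f \<omega>) * exp (t * W g \<omega>) \<partial>M)
      has_real_derivative (\<integral>\<omega>. exp (W f \<omega>) * W g \<omega> \<partial>M)) (at 0)"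
    by (rule has_derivative_exp_integral_at_0[OF all_exp_moments_W[OF square_integrable_exp_W]])
  moreover have "(\<integral>\<omega>. exp (W f \<omega>) * exp (t * W g \<omega>) \<partial>M) = exp ((f \<bullet> f + 2 * t * (g \<bullet> f) + t\<^sup>2 * (g \<bullet> g)) / 2)" for t
    using exp_W_add_scaled[of "\<lambda>_. 1" f t g] unfolding integral_exp_W mult_1 power2_norm_eq_inner
    by (simp add: inner_commute algebra_simps power2_eq_square)
  moreover have "((\<lambda>t. exp ((f \<bullet> f + 2 * t * (g \<bullet> f) + t\<^sup>2 * (g \<bullet> g)) / 2))
      has_real_derivative (g \<bullet> f) * exp ((f \<bullet> f) / 2)) (at 0)"
    by (auto intro!: derivative_eq_intros)
  ultimately have "(\<integral>\<omega>. exp (W f \<omega>) * W g \<omega> \<partial>M) = (g \<bullet> f) * exp ((f \<bullet> f) / 2)"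
    using DERIV_unique by simp
  then show ?thesis by (simp add: mult.commute power2_norm_eq_inner)
qed

text \<open>
  The signed measure with density \<open>\<xi>\<close> has a characteristic function that vanishes on \<open>V\<close>. Unlike the
  vanishing of a Laplace transform, this condition makes sense for merely integrable weights and is
  inherited when a weight is restricted to an event generated by the family.
\<close>

definition fourier_null :: "'h set \<Rightarrow> ('a \<Rightarrow> real) \<Rightarrow> bool" where
  "fourier_null V \<xi> \<longleftrightarrow> integrable M \<xi> \<and>
     (\<forall>f\<in>V. (CLINT \<omega>|M. of_real (\<xi> \<omega>) * iexp (W f \<omega>)) = 0)"

lemma fourier_null_if_laplace_null:
  assumes \<xi>: "square_integrable M \<xi>" and V: "subspace V"
    and laplace: "\<And>f. f \<in> V \<Longrightarrow> (\<integral>\<omega>. \<xi> \<omega> * exp (W f \<omega>) \<partial>M) = 0"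
  shows "fourier_null V \<xi>"
  unfolding fourier_null_def
proof (intro conjI ballI)
  show "integrable M \<xi>" by (rule square_integrable_imp_integrable[OF \<xi>])
  fix f assume f: "f \<in> V"
  have [measurable]: "\<xi> \<in> borel_measurable M" using \<xi> by (simp add: square_integrable_def)
  show "(CLINT \<omega>|M. of_real (\<xi> \<omega>) * iexp (W f \<omega>)) = 0"
  proof (rule fourier_zero_if_laplace_zero[OF all_exp_moments_W[OF \<xi>]])
    fix t
    have "(\<integral>\<omega>. \<xi> \<omega> * exp (t * W f \<omega>) \<partial>M) = (\<integral>\<omega>. \<xi> \<omega> * exp (W (t *\<^sub>R f) \<omega>) \<partial>M)"
      by (rule integral_cong_AE, measurable) (use W_scale[of t f] in \<open>auto elim: eventually_mono\<close>)
    then show "(\<integral>\<omega>. \<xi> \<omega> * exp (t * W f \<omega>) \<partial>M) = 0"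
      using laplace[OF subspace_scale[OF V f]] by simp
  qed
qed

lemma fourier_null_diff:
  assumes "fourier_null V \<xi>" "fourier_null V \<zeta>"
  shows "fourier_null V (\<lambda>\<omega>. \<xi> \<omega> - \<zeta> \<omega>)"
proof -
  have "complex_integrable M (\<lambda>\<omega>. of_real (w \<omega>) * iexp (W f \<omega>))" if "integrable M w" for w f
    by (rule Bochner_Integration.integrable_bound[OF that]) (use that in \<open>auto simp: norm_mult\<close>)
  with assms show ?thesis unfolding fourier_null_def by (auto simp: left_diff_distrib)
qed

text \<open>
  Fix \<open>f\<close> in \<open>V\<close>. The weights $\xi \cos W(f)$ and $\xi \sin W(f)$ have vanishing Fourier transform in
  the direction \<open>g\<close>, because $f$ and $g$ combine inside \<open>V\<close>; by the one-dimensional uniqueness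
  theorem they integrate to $0$ over the event. Keeping all of \<open>V\<close> in the conclusion allows the
  step to be iterated over several generators.
\<close>

lemma fourier_null_restrict_generator:
  assumes \<xi>: "fourier_null V \<xi>" and V: "subspace V" "g \<in> V"
    and [measurable]: "B \<in> sets borel" "Y \<in> borel_measurable M" and Y: "AE \<omega> in M. Y \<omega> = W g \<omega>"
  shows "fourier_null V (\<lambda>\<omega>. \<xi> \<omega> * indicator (Y -` B \<inter> space M) \<omega>)"
  unfolding fourier_null_def
proof (intro conjI ballI)
  have int: "integrable M \<xi>" using \<xi> by (simp add: fourier_null_def)
  then have [measurable]: "\<xi> \<in> borel_measurable M" by simp
  show "integrable M (\<lambda>\<omega>. \<xi> \<omega> * indicator (Y -` B \<inter> space M) \<omega>)"
    by (intro integrable_real_mult_indicator int) measurable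
  fix f assume f: "f \<in> V"
  have intc: "complex_integrable M (\<lambda>\<omega>. of_real (\<xi> \<omega>) * iexp (w \<omega>))" 
    if [measurable]: "w \<in> borel_measurable M" for w
    by (rule Bochner_Integration.integrable_bound[OF int]) (auto simp: norm_mult)
  have null: "(CLINT \<omega>|M. of_real (\<xi> \<omega>) * iexp (a * W f \<omega> + t * W g \<omega>)) = 0" for a t
  proof -
    have "(CLINT \<omega>|M. of_real (\<xi> \<omega>) * iexp (a * W f \<omega> + t * W g \<omega>))
        = (CLINT \<omega>|M. of_real (\<xi> \<omega>) * iexp (W (a *\<^sub>R f + t *\<^sub>R g) \<omega>))"
      by (rule integral_cong_AE, measurable) (use W_linear[of a f t g] in \<open>auto elim: eventually_mono\<close>)
    also have "\<dots> = 0"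
      using \<xi> V f by (simp add: fourier_null_def subspace_add subspace_scale)
    finally show ?thesis .
  qed
  have trig: "(\<integral>\<omega>. (\<xi> \<omega> * trig (W f \<omega>)) * indicator B (W g \<omega>) \<partial>M) = 0"
    if trig: "\<And>x. complex_of_real (trig x) = c * iexp (1 * x) + d * iexp ((- 1) * x)"
      and [measurable]: "trig \<in> borel_measurable borel" and "\<And>x. \<bar>trig x\<bar> \<le> 1"
    for trig :: "real \<Rightarrow> real" and c d
  proof (rule weighted_law_zero_if_fourier_zero)
    show "integrable M (\<lambda>\<omega>. \<xi> \<omega> * trig (W f \<omega>))"
      by (rule Bochner_Integration.integrable_bound[OF int])
         (use that(3) in \<open>auto simp: abs_mult mult_left_le\<close>)
    show "(CLINT \<omega>|M. of_real (\<xi> \<omega> * trig (W f \<omega>)) * iexp (t * W g \<omega>)) = 0" for t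
    proof -
      have "of_real (\<xi> \<omega> * trig (W f \<omega>)) * iexp (t * W g \<omega>)
          = c * (of_real (\<xi> \<omega>) * iexp (1 * W f \<omega> + t * W g \<omega>))
            + d * (of_real (\<xi> \<omega>) * iexp ((- 1) * W f \<omega> + t * W g \<omega>))" for \<omega>
        unfolding of_real_mult trig of_real_add distrib_left exp_add by (simp add: algebra_simps)
      then have "(CLINT \<omega>|M. of_real (\<xi> \<omega> * trig (W f \<omega>)) * iexp (t * W g \<omega>))
          = c * (CLINT \<omega>|M. of_real (\<xi> \<omega>) * iexp (1 * W f \<omega> + t * W g \<omega>))
            + d * (CLINT \<omega>|M. of_real (\<xi> \<omega>) * iexp ((- 1) * W f \<omega> + t * W g \<omega>))"
        by (simp only: integral_mult_right_zero Bochner_Integration.integral_add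
            integrable_mult_right intc borel_measurable_add borel_measurable_times
            borel_measurable_const W_measurable)
      then show ?thesis by (simp only: null) simp
    qed
  qed measurable
  have cos0: "(\<integral>\<omega>. (\<xi> \<omega> * cos (W f \<omega>)) * indicator B (W g \<omega>) \<partial>M) = 0"
    by (rule trig[of cos "1/2" "1/2"])
       (auto simp: cos_exp_eq cos_of_real[symmetric] field_simps)
  have sin0: "(\<integral>\<omega>. (\<xi> \<omega> * sin (W f \<omega>)) * indicator B (W g \<omega>) \<partial>M) = 0"
    by (rule trig[of sin "- \<i> / 2" "\<i> / 2"])
       (auto simp: sin_exp_eq sin_of_real[symmetric] field_simps)
  have intt: "integrable M (\<lambda>\<omega>. (\<xi> \<omega> * trig (W f \<omega>)) * indicator B (W g \<omega>))"
    if [measurable]: "trig \<in> borel_measurable borel" and "\<And>x. \<bar>trig x\<bar> \<le> 1" for trig :: "real \<Rightarrow> real"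
    by (rule Bochner_Integration.integrable_bound[OF int])
       (use that(2) in \<open>auto simp: abs_mult mult_left_le indicator_def\<close>)
  have "(CLINT \<omega>|M. of_real (\<xi> \<omega> * indicator (Y -` B \<inter> space M) \<omega>) * iexp (W f \<omega>))
      = (CLINT \<omega>|M. of_real ((\<xi> \<omega> * cos (W f \<omega>)) * indicator B (W g \<omega>))
          + \<i> * of_real ((\<xi> \<omega> * sin (W f \<omega>)) * indicator B (W g \<omega>)))"
  proof (rule integral_cong_AE)
    show "AE \<omega> in M. of_real (\<xi> \<omega> * indicator (Y -` B \<inter> space M) \<omega>) * iexp (W f \<omega>)
        = of_real ((\<xi> \<omega> * cos (W f \<omega>)) * indicator B (W g \<omega>))
          + \<i> * of_real ((\<xi> \<omega> * sin (W f \<omega>)) * indicator B (W g \<omega>))"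
      using Y AE_space
    proof eventually_elim
      case (elim \<omega>)
      have "iexp (W f \<omega>) = of_real (cos (W f \<omega>)) + \<i> * of_real (sin (W f \<omega>))"
        by (simp add: exp_Euler cos_of_real sin_of_real)
      with elim show ?case by (simp add: indicator_def algebra_simps)
    qed
  qed measurable
  also have "\<dots> = 0"
    using intt[of cos] intt[of sin]
    by (subst Bochner_Integration.integral_add)
       (simp_all only: integral_mult_right_zero integral_complex_of_real cos0 sin0
          integrable_mult_right integrable_of_real abs_cos_le_one abs_sin_le_one
          borel_measurable_cos borel_measurable_sin of_real_0 measurable_ident mult_zero_right add_0)
  finally show "(CLINT \<omega>|M. of_real (\<xi> \<omega> * indicator (Y -` B \<inter> space M) \<omega>) * iexp (W f \<omega>)) = 0" .
qed

text \<open>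
  The events that may be imposed on every Fourier-null weight are closed under complements, and
  under intersections because impositions can be iterated. With dominated convergence they form a
  $\sigma$-algebra, so it suffices that they include the generators.
\<close>

lemma fourier_null_restrict:
  assumes V: "subspace V" and \<xi>: "fourier_null V \<xi>"
    and gen: "\<And>s. s \<in> S \<Longrightarrow> Y s \<in> borel_measurable M"
      "\<And>s. s \<in> S \<Longrightarrow> v s \<in> V" "\<And>s. s \<in> S \<Longrightarrow> AE \<omega> in M. Y s \<omega> = W (v s) \<omega>"
    and A: "A \<in> sigma_sets (space M) {Y s -` B \<inter> space M | s B. s \<in> S \<and> B \<in> sets borel}"
  shows "fourier_null V (\<lambda>\<omega>. \<xi> \<omega> * indicator A \<omega>)"
proof -
  let ?G = "{Y s -` B \<inter> space M | s B. s \<in> S \<and> B \<in> sets borel}"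
  have G_sets: "sigma_sets (space M) ?G \<subseteq> sets M"
    by (rule sets.sigma_sets_subset) (use gen(1) in \<open>auto intro: measurable_sets\<close>)
  have "\<forall>\<xi>. fourier_null V \<xi> \<longrightarrow> fourier_null V (\<lambda>\<omega>. \<xi> \<omega> * indicator A \<omega>)"
    using A
  proof (induction A rule: sigma_sets.induct)
    case (Basic A)
    then show ?case using fourier_null_restrict_generator[OF _ V] gen by blast
  next
    case Empty
    show ?case by (simp add: fourier_null_def)
  next
    case (Compl A)
    show ?case
    proof (intro allI impI)
      fix \<xi> assume \<xi>: "fourier_null V \<xi>"
      have "fourier_null V (\<lambda>\<omega>. \<xi> \<omega> - \<xi> \<omega> * indicator A \<omega>)"
        using Compl.IH \<xi> by (intro fourier_null_diff) auto
      moreover have "\<xi> \<omega> - \<xi> \<omega> * indicator A \<omega> = \<xi> \<omega> * indicator (space M - A) \<omega>"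
        if "\<omega> \<in> space M" for \<omega> using that by (simp add: indicator_def)
      ultimately show "fourier_null V (\<lambda>\<omega>. \<xi> \<omega> * indicator (space M - A) \<omega>)"
        unfolding fourier_null_def
        by (simp cong: Bochner_Integration.integrable_cong Bochner_Integration.integral_cong)
    qed
  next
    case (Union A)
    have A_sets [measurable]: "A i \<in> sets M" for i using Union.hyps G_sets by blast
    show ?case
    proof (intro allI impI)
      fix \<xi> assume \<xi>: "fourier_null V \<xi>"
      then have int: "integrable M \<xi>" by (simp add: fourier_null_def)
      then have [measurable]: "\<xi> \<in> borel_measurable M" by simp
      \<comment> \<open>The complement of a finite union arises by imposing the complements one after another.\<close>
      have fin: "fourier_null V (\<lambda>\<omega>. \<xi> \<omega> * indicator (- (\<Union>i<n. A i)) \<omega>)" for n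
      proof (induction n)
        case 0 then show ?case using \<xi> by simp
      next
        case (Suc n)
        have "fourier_null V (\<lambda>\<omega>. \<xi> \<omega> * indicator (- (\<Union>i<n. A i)) \<omega>
            - (\<xi> \<omega> * indicator (- (\<Union>i<n. A i)) \<omega>) * indicator (A n) \<omega>)"
          using Union.IH Suc by (intro fourier_null_diff) auto
        moreover have "\<xi> \<omega> * indicator (- (\<Union>i<n. A i)) \<omega>
            - (\<xi> \<omega> * indicator (- (\<Union>i<n. A i)) \<omega>) * indicator (A n) \<omega>
            = \<xi> \<omega> * indicator (- (\<Union>i<Suc n. A i)) \<omega>" for \<omega>
          by (auto simp: indicator_def lessThan_Suc)
        ultimately show ?case by simp
      qed
      have fin': "fourier_null V (\<lambda>\<omega>. \<xi> \<omega> * indicator (\<Union>i<n. A i) \<omega>)" for n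
      proof -
        have "\<xi> \<omega> - \<xi> \<omega> * indicator (- (\<Union>i<n. A i)) \<omega> = \<xi> \<omega> * indicator (\<Union>i<n. A i) \<omega>" for \<omega>
          by (auto simp: indicator_def)
        with fourier_null_diff[OF \<xi> fin[of n]] show ?thesis by simp
      qed
      show "fourier_null V (\<lambda>\<omega>. \<xi> \<omega> * indicator (\<Union>i. A i) \<omega>)"
        unfolding fourier_null_def
      proof (intro conjI ballI)
        show "integrable M (\<lambda>\<omega>. \<xi> \<omega> * indicator (\<Union>i. A i) \<omega>)"
          by (intro integrable_real_mult_indicator int) measurable
        fix f assume f: "f \<in> V"
        have "(\<lambda>n. CLINT \<omega>|M. of_real (\<xi> \<omega> * indicator (\<Union>i<n. A i) \<omega>) * iexp (W f \<omega>))
            \<longlonglongrightarrow> (CLINT \<omega>|M. of_real (\<xi> \<omega> * indicator (\<Union>i. A i) \<omega>) * iexp (W f \<omega>))"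
        proof (rule integral_dominated_convergence[where w="\<lambda>\<omega>. \<bar>\<xi> \<omega>\<bar>"])
          show "AE \<omega> in M. (\<lambda>n. of_real (\<xi> \<omega> * indicator (\<Union>i<n. A i) \<omega>) * iexp (W f \<omega>))
              \<longlonglongrightarrow> of_real (\<xi> \<omega> * indicator (\<Union>i. A i) \<omega>) * iexp (W f \<omega>)"
            by (intro AE_I2 tendsto_intros LIMSEQ_indicator_UN)
          show "AE \<omega> in M. norm (of_real (\<xi> \<omega> * indicator (\<Union>i<n. A i) \<omega>) * iexp (W f \<omega>)) \<le> \<bar>\<xi> \<omega>\<bar>" for n
            by (intro AE_I2) (auto simp: norm_mult indicator_def)
        qed (use int in \<open>simp_all, measurable?\<close>)
        moreover have "(CLINT \<omega>|M. of_real (\<xi> \<omega> * indicator (\<Union>i<n. A i) \<omega>) * iexp (W f \<omega>)) = 0" for n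
          using fin'[of n] f unfolding fourier_null_def by blast
        ultimately show "(CLINT \<omega>|M. of_real (\<xi> \<omega> * indicator (\<Union>i. A i) \<omega>) * iexp (W f \<omega>)) = 0"
          using LIMSEQ_unique[OF _ tendsto_const] by fastforce
      qed
    qed
  qed
  with \<xi> show ?thesis by blast
qed

text \<open>
  For $V$ the whole space this is the totality of the exponentials $e^{W(f)}$; a proper subspace
  localises the statement to the $\sigma$-algebra that it generates.
\<close>

theorem laplace_null_imp_null_on_sigma_algebra:
  assumes "square_integrable M \<xi>" and V: "subspace V"
    and "\<And>f. f \<in> V \<Longrightarrow> (\<integral>\<omega>. \<xi> \<omega> * exp (W f \<omega>) \<partial>M) = 0"
    and "\<And>s. s \<in> S \<Longrightarrow> Y s \<in> borel_measurable M"
      "\<And>s. s \<in> S \<Longrightarrow> v s \<in> V" "\<And>s. s \<in> S \<Longrightarrow> AE \<omega> in M. Y s \<omega> = W (v s) \<omega>"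
    and A: "A \<in> sigma_sets (space M) {Y s -` B \<inter> space M | s B. s \<in> S \<and> B \<in> sets borel}"
  shows "(\<integral>\<omega>\<in>A. \<xi> \<omega> \<partial>M) = 0"
proof -
  have "fourier_null V (\<lambda>\<omega>. \<xi> \<omega> * indicator A \<omega>)"
    using assms by (intro fourier_null_restrict[OF V fourier_null_if_laplace_null _ _ _ A]) auto
  then have "(CLINT \<omega>|M. of_real (\<xi> \<omega> * indicator A \<omega>) * iexp (W 0 \<omega>)) = 0"
    and int: "integrable M (\<lambda>\<omega>. \<xi> \<omega> * indicator A \<omega>)"
    using subspace_0[OF V] unfolding fourier_null_def by auto
  moreover have "(CLINT \<omega>|M. of_real (\<xi> \<omega> * indicator A \<omega>) * iexp (W 0 \<omega>))
      = (CLINT \<omega>|M. of_real (\<xi> \<omega> * indicator A \<omega>))"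
  proof (rule integral_cong_AE)
    have [measurable]: "(\<lambda>\<omega>. \<xi> \<omega> * indicator A \<omega>) \<in> borel_measurable M" using int by simp
    show "(\<lambda>\<omega>. complex_of_real (\<xi> \<omega> * indicator A \<omega>)) \<in> borel_measurable M" by measurable
    show "(\<lambda>\<omega>. complex_of_real (\<xi> \<omega> * indicator A \<omega>) * iexp (W 0 \<omega>)) \<in> borel_measurable M" by measurable
  qed (use W_zero in \<open>auto elim: eventually_mono\<close>)
  ultimately have "(\<integral>\<omega>. \<xi> \<omega> * indicator A \<omega> \<partial>M) = 0"
    by (simp only: integral_complex_of_real) simp
  then show ?thesis by (simp add: set_lebesgue_integral_def mult.commute)
qed

end

section \<open>The Wiener integral of a centered Gaussian process\<close>

lemma (in prob_space) gaussian_rv_centered: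
  assumes gauss: "gaussian_rv M Y" and mean: "(\<integral>\<omega>. Y \<omega> \<partial>M) = 0"
  shows "square_integrable M Y"
    and "char (distr M borel Y) t = of_real (exp (- (t * L2_norm M Y)\<^sup>2 / 2))"
proof -
  have [measurable]: "Y \<in> borel_measurable M" using gauss by (simp add: gaussian_rv_def)
  obtain \<mu> \<sigma> where \<sigma>: "0 \<le> \<sigma>"
    "if \<sigma> = 0 then AE \<omega> in M. Y \<omega> = \<mu> else distributed M lborel Y (\<lambda>x. ennreal (normal_density \<mu> \<sigma> x))"
    using gauss by (auto simp: gaussian_rv_def)
  have "square_integrable M Y \<and> char (distr M borel Y) t = of_real (exp (- (t * L2_norm M Y)\<^sup>2 / 2))"
  proof (cases "\<sigma> = 0")
    case True
    then have ae: "AE \<omega> in M. Y \<omega> = \<mu>" using \<sigma> by simp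
    then have "(\<integral>\<omega>. Y \<omega> \<partial>M) = (\<integral>\<omega>. \<mu> \<partial>M)" by (intro integral_cong_AE) auto
    then have "\<mu> = 0" using mean by (simp add: prob_space)
    with ae have ae0: "AE \<omega> in M. Y \<omega> = 0" by simp
    have "square_integrable M Y"
      unfolding square_integrable_def using ae0
      by (subst integrable_cong_AE[where g = "\<lambda>_. 0"]) (auto elim: eventually_mono)
    moreover have "L2_norm M Y = 0"
      unfolding L2_norm_def using ae0 by (simp add: integral_eq_zero_AE)
    moreover have "char (distr M borel Y) t = (CLINT \<omega>|M. iexp (t * Y \<omega>))"
      unfolding char_def by (subst integral_distr) auto
    moreover have "(CLINT \<omega>|M. iexp (t * Y \<omega>)) = (CLINT \<omega>|M. 1)"
      by (rule integral_cong_AE, measurable) (use ae0 in \<open>auto elim: eventually_mono\<close>)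
    ultimately show ?thesis by (simp add: prob_space)
  next
    case False
    then have pos: "0 < \<sigma>" and dist: "distributed M lborel Y (\<lambda>x. ennreal (normal_density \<mu> \<sigma> x))"
      using \<sigma> by auto
    have \<mu>: "\<mu> = 0" using normal_distributed_expectation[OF pos dist] mean by simp
    note dist = dist[unfolded \<mu>]
    have "integrable M (\<lambda>\<omega>. (Y \<omega>)\<^sup>2)"
      using integrable_normal_moment[OF pos, of 0 2]
      by (subst distributed_integrable[OF dist, symmetric]) auto
    then have sq: "square_integrable M Y" unfolding square_integrable_def by simp
    have "(\<integral>\<omega>. (Y \<omega>)\<^sup>2 \<partial>M) = \<sigma>\<^sup>2"
      using normal_distributed_variance[OF pos dist] mean by simp
    then have norm: "L2_norm M Y = \<sigma>" using pos by (simp add: L2_norm_def)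
    have "distr M borel Y = distr M lborel Y" by (rule distr_cong) auto
    also have "\<dots> = density lborel (\<lambda>x. ennreal (normal_density 0 \<sigma> x))"
      using dist by (simp add: distributed_def)
    finally show ?thesis using sq by (simp add: char_normal_density[OF pos] norm)
  qed
  then show "square_integrable M Y"
    and "char (distr M borel Y) t = of_real (exp (- (t * L2_norm M Y)\<^sup>2 / 2))" by auto
qed

text \<open>
  Characteristic functions depend continuously on the variable in mean square; this carries Gaussian
  laws from finite sums to their mean-square limits.
\<close>

lemma (in prob_space) char_dist_le_L2_norm:
  assumes [measurable]: "square_integrable M x" "square_integrable M y"
  shows "norm (char (distr M borel x) t - char (distr M borel y) t) \<le> \<bar>t\<bar> * L2_norm M (\<lambda>\<omega>. x \<omega> - y \<omega>)"
proof -
  have int: "complex_integrable M (\<lambda>\<omega>. iexp (t * z \<omega>))" if [measurable]: "z \<in> borel_measurable M" for z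
    by (rule integrable_const_bound[where B=1]) auto
  have iexp_lipschitz: "norm (iexp a - iexp b) \<le> \<bar>a - b\<bar>" for a b
  proof -
    have "iexp a - iexp b = iexp b * (iexp (a - b) - 1)"
      by (simp add: algebra_simps exp_add[symmetric])
    moreover have "norm (iexp (a - b) - 1) \<le> \<bar>a - b\<bar>" using iexp_approx1[of "a - b" 0] by simp
    ultimately show ?thesis by (simp add: norm_mult)
  qed
  have int_abs: "integrable M (\<lambda>\<omega>. \<bar>x \<omega> - y \<omega>\<bar>)"
    by (intro integrable_abs square_integrable_imp_integrable square_integrable_diff assms)
  have "char (distr M borel z) t = (CLINT \<omega>|M. iexp (t * z \<omega>))" if [measurable]: "z \<in> borel_measurable M" for z
    unfolding char_def by (subst integral_distr) auto
  then have "char (distr M borel x) t - char (distr M borel y) t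
      = (CLINT \<omega>|M. iexp (t * x \<omega>) - iexp (t * y \<omega>))"
    using int assms by (subst Bochner_Integration.integral_diff) (auto simp: square_integrable_def)
  also have "norm \<dots> \<le> (\<integral>\<omega>. norm (iexp (t * x \<omega>) - iexp (t * y \<omega>)) \<partial>M)"
    by (rule integral_norm_bound)
  also have "\<dots> \<le> (\<integral>\<omega>. \<bar>t\<bar> * \<bar>x \<omega> - y \<omega>\<bar> \<partial>M)"
  proof (rule integral_mono)
    show "integrable M (\<lambda>\<omega>. norm (iexp (t * x \<omega>) - iexp (t * y \<omega>)))"
      using int assms by (intro integrable_norm Bochner_Integration.integrable_diff) (auto simp: square_integrable_def)
    show "integrable M (\<lambda>\<omega>. \<bar>t\<bar> * \<bar>x \<omega> - y \<omega>\<bar>)" using int_abs by simp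
    show "norm (iexp (t * x \<omega>) - iexp (t * y \<omega>)) \<le> \<bar>t\<bar> * \<bar>x \<omega> - y \<omega>\<bar>" for \<omega>
      using iexp_lipschitz[of "t * x \<omega>" "t * y \<omega>"] by (simp add: abs_mult[symmetric] right_diff_distrib)
  qed
  also have "\<dots> \<le> \<bar>t\<bar> * L2_norm M (\<lambda>\<omega>. x \<omega> - y \<omega>)"
    using integral_abs_le_L2_norm[OF square_integrable_diff[OF assms]] by (simp add: mult_left_mono)
  finally show ?thesis .
qed

locale gaussian_integrands = prob_space M for M :: "'a measure" +
  fixes T :: real and X :: "real \<Rightarrow> 'a \<Rightarrow> real"
    and J :: "(real \<Rightarrow> real) \<Rightarrow> 'h::{real_inner, complete_space}"
  assumes gaussian: "centered_gaussian_process M T X"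
    and integrands: "integrand_space M T X J"
begin

abbreviation time_integrand :: "real \<Rightarrow> 'h" where
  "time_integrand t \<equiv> J (indicat_real {0<..t})"

definition elementary_integrand :: "real set \<Rightarrow> (real \<Rightarrow> real) \<Rightarrow> 'h" where
  "elementary_integrand F c = (\<Sum>t\<in>F. c t *\<^sub>R time_integrand t)"

definition elementary_integral :: "real set \<Rightarrow> (real \<Rightarrow> real) \<Rightarrow> 'a \<Rightarrow> real" where
  "elementary_integral F c \<omega> = (\<Sum>t\<in>F. c t * X t \<omega>)"

lemma elementary_integral_gaussian:
  assumes "finite F" "F \<subseteq> {0..T}"
  shows "gaussian_rv M (elementary_integral F c)"
  using gaussian assms unfolding centered_gaussian_process_def elementary_integral_def[abs_def] by simp

lemma X_square_integrable:
  assumes "t \<in> {0..T}"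
  shows "square_integrable M (X t)"
proof (rule gaussian_rv_centered)
  show "gaussian_rv M (X t)"
    using elementary_integral_gaussian[of "{t}" "\<lambda>_. 1"] assms by (simp add: elementary_integral_def[abs_def])
  show "(\<integral>\<omega>. X t \<omega> \<partial>M) = 0" using gaussian assms by (simp add: centered_gaussian_process_def)
qed

lemma X_measurable: "t \<in> {0..T} \<Longrightarrow> X t \<in> borel_measurable M"
  using X_square_integrable by (simp add: square_integrable_def)

lemma X_integrable: "t \<in> {0..T} \<Longrightarrow> integrable M (X t)"
  by (rule square_integrable_imp_integrable[OF X_square_integrable])

lemma natural_filtration_subalgebra:
  assumes "r \<le> T"
  shows "subalgebra M (natural_filtration M X r)"
proof -
  have "{X s -` B \<inter> space M |s B. s \<in> {0..r} \<and> B \<in> sets borel} \<subseteq> sets M"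
    using assms by (auto intro!: measurable_sets[OF X_measurable])
  then show ?thesis
    unfolding subalgebra_def natural_filtration_def
    by (simp add: space_measure_of_conv sets.sigma_sets_subset sets_measure_of_conv)
qed

lemma sets_natural_filtration:
  "sets (natural_filtration M X r)
    = sigma_sets (space M) {X s -` B \<inter> space M |s B. s \<in> {0..r} \<and> B \<in> sets borel}"
  unfolding natural_filtration_def by (rule sets_measure_of) auto

lemma X_adapted:
  assumes "0 \<le> s" "s \<le> r"
  shows "X s \<in> borel_measurable (natural_filtration M X r)"
proof (rule measurableI)
  fix B :: "real set" assume "B \<in> sets borel"
  moreover have "space (natural_filtration M X r) = space M"
    unfolding natural_filtration_def by (rule space_measure_of_conv)
  ultimately show "X s -` B \<inter> space (natural_filtration M X r) \<in> sets (natural_filtration M X r)"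
    unfolding sets_natural_filtration using assms by (auto intro!: sigma_sets.Basic)
qed simp

lemma L2_X_iff:
  "\<xi> \<in> L2_X M T X \<longleftrightarrow> \<xi> \<in> borel_measurable (natural_filtration M X T) \<and> square_integrable M \<xi>"
  unfolding L2_X_def square_integrable_def
  using measurable_from_subalg[OF natural_filtration_subalgebra[OF order_refl]] by auto

lemma L2_X_combination:
  assumes "\<xi> \<in> L2_X M T X" "\<zeta> \<in> L2_X M T X"
  shows "(\<lambda>\<omega>. a * \<xi> \<omega> + b * \<zeta> \<omega>) \<in> L2_X M T X"
  using assms unfolding L2_X_iff by (auto intro!: square_integrable_combination)

lemma elementary_integral_L2_X:
  assumes "F \<subseteq> {0..T}"
  shows "elementary_integral F c \<in> L2_X M T X"
  unfolding L2_X_iff elementary_integral_def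
  using assms X_adapted[of _ T] X_square_integrable
  by (auto intro!: square_integrable_sum borel_measurable_sum borel_measurable_times)

lemma elementary_integral_square_integrable: "F \<subseteq> {0..T} \<Longrightarrow> square_integrable M (elementary_integral F c)"
  using elementary_integral_L2_X L2_X_iff by blast

lemma elementary_combination:
  assumes "finite F" "F \<subseteq> {0..T}" "finite G" "G \<subseteq> {0..T}"
  obtains H k where "finite H" "H \<subseteq> {0..T}"
    "elementary_integrand H k = a *\<^sub>R elementary_integrand F c + b *\<^sub>R elementary_integrand G d"
    "elementary_integral H k = (\<lambda>\<omega>. a * elementary_integral F c \<omega> + b * elementary_integral G d \<omega>)"
proof
  define k where "k t = a * (if t \<in> F then c t else 0) + b * (if t \<in> G then d t else 0)" for t
  show "finite (F \<union> G)" "F \<union> G \<subseteq> {0..T}" using assms by auto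
  have ext: "(\<Sum>t\<in>F \<union> G. (if t \<in> A then m t else 0) *\<^sub>R z t) = (\<Sum>t\<in>A. m t *\<^sub>R z t)"
    if "A \<subseteq> F \<union> G" for A m and z :: "real \<Rightarrow> 'z::real_vector"
  proof -
    have "(\<Sum>t\<in>F \<union> G. (if t \<in> A then m t else 0) *\<^sub>R z t) = (\<Sum>t\<in>A. (if t \<in> A then m t else 0) *\<^sub>R z t)"
      using assms that by (intro sum.mono_neutral_right) auto
    then show ?thesis by simp
  qed
  have lin: "(\<Sum>t\<in>F \<union> G. k t *\<^sub>R z t) = a *\<^sub>R (\<Sum>t\<in>F. c t *\<^sub>R z t) + b *\<^sub>R (\<Sum>t\<in>G. d t *\<^sub>R z t)"
    for z :: "real \<Rightarrow> 'z::real_vector"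
    unfolding ext[of F c z, OF Un_upper1, symmetric] ext[of G d z, OF Un_upper2, symmetric] k_def
    by (simp only: scaleR_sum_right sum.distrib scaleR_add_left scaleR_scaleR)
  show "elementary_integrand (F \<union> G) k = a *\<^sub>R elementary_integrand F c + b *\<^sub>R elementary_integrand G d"
    unfolding elementary_integrand_def by (rule lin)
  show "elementary_integral (F \<union> G) k = (\<lambda>\<omega>. a * elementary_integral F c \<omega> + b * elementary_integral G d \<omega>)"
    unfolding elementary_integral_def fun_eq_iff using lin[of "\<lambda>t. X t _"] by simp
qed

lemma inner_time_integrand:
  "t \<in> {0..T} \<Longrightarrow> s \<in> {0..T} \<Longrightarrow> time_integrand t \<bullet> time_integrand s = (\<integral>\<omega>. X t \<omega> * X s \<omega> \<partial>M)"
  using integrands unfolding integrand_space_def covariance_def by blast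

lemma L2_norm_elementary_integral:
  assumes "finite F" "F \<subseteq> {0..T}"
  shows "L2_norm M (elementary_integral F c) = norm (elementary_integrand F c)"
proof -
  have int: "integrable M (\<lambda>\<omega>. X t \<omega> * X s \<omega>)" if "t \<in> F" "s \<in> F" for s t
    using assms that by (intro square_integrable_mult X_square_integrable) auto
  have "(elementary_integral F c \<omega>)\<^sup>2 = (\<Sum>t\<in>F. \<Sum>s\<in>F. c t * c s * (X t \<omega> * X s \<omega>))" for \<omega>
    unfolding elementary_integral_def power2_eq_square sum_product by (intro sum.cong refl) simp
  then have "(L2_norm M (elementary_integral F c))\<^sup>2 = (\<integral>\<omega>. (\<Sum>t\<in>F. \<Sum>s\<in>F. c t * c s * (X t \<omega> * X s \<omega>)) \<partial>M)"
    by (simp only: L2_norm_power2)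
  also have "\<dots> = (\<Sum>t\<in>F. \<Sum>s\<in>F. c t * c s * (\<integral>\<omega>. X t \<omega> * X s \<omega> \<partial>M))"
    using int by (simp add: Bochner_Integration.integral_sum)
  also have "\<dots> = (\<Sum>t\<in>F. \<Sum>s\<in>F. c t * c s * (time_integrand t \<bullet> time_integrand s))"
    using assms by (intro sum.cong refl) (auto simp: inner_time_integrand subset_iff)
  also have "\<dots> = (norm (elementary_integrand F c))\<^sup>2"
    unfolding power2_norm_eq_inner elementary_integrand_def
    by (simp add: inner_sum_left inner_sum_right sum_distrib_left ac_simps inner_commute)
  finally show ?thesis by (simp add: L2_norm_nonneg)
qed

lemma char_elementary_integral:
  assumes "finite F" "F \<subseteq> {0..T}"
  shows "char (distr M borel (elementary_integral F c)) t
    = of_real (exp (- (t * norm (elementary_integrand F c))\<^sup>2 / 2))"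
proof -
  have "(\<integral>\<omega>. elementary_integral F c \<omega> \<partial>M) = (\<Sum>t\<in>F. c t * (\<integral>\<omega>. X t \<omega> \<partial>M))"
    using assms X_integrable unfolding elementary_integral_def
    by (subst Bochner_Integration.integral_sum) auto
  then have "(\<integral>\<omega>. elementary_integral F c \<omega> \<partial>M) = 0"
    using gaussian assms by (auto simp: centered_gaussian_process_def subset_iff intro!: sum.neutral)
  from gaussian_rv_centered(2)[OF elementary_integral_gaussian[OF assms] this] show ?thesis
    by (simp only: L2_norm_elementary_integral[OF assms])
qed

lemma J_step_function:
  assumes "finite F" "F \<subseteq> {0..T}"
  shows "J (\<lambda>u. \<Sum>t\<in>F. c t * indicat_real {0<..t} u) = elementary_integrand F c"
proof -
  have step: "(\<lambda>u. \<Sum>t\<in>F. c t * indicat_real {0<..t} u) \<in> step_functions T"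
    if "finite F" "F \<subseteq> {0..T}" for F c
    unfolding step_functions_def using that by blast
  have lin: "J (\<lambda>u. a * f u + b * g u) = a *\<^sub>R J f + b *\<^sub>R J g"
    if "f \<in> step_functions T" "g \<in> step_functions T" for f g a b
    using integrands that unfolding integrand_space_def by blast
  show ?thesis
    using assms
  proof (induction F rule: finite_induct)
    case empty
    show ?case using lin[OF step step, of "{}" "{}" 0 _ 0] by (simp add: elementary_integrand_def)
  next
    case (insert t F)
    have "indicat_real {0<..t} \<in> step_functions T"
      using step[of "{t}" "\<lambda>_. 1"] insert.prems by simp
    then have "J (\<lambda>u. c t * indicat_real {0<..t} u + 1 * (\<Sum>t\<in>F. c t * indicat_real {0<..t} u))
        = c t *\<^sub>R time_integrand t + 1 *\<^sub>R J (\<lambda>u. \<Sum>t\<in>F. c t * indicat_real {0<..t} u)"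
      using insert step by (intro lin) auto
    moreover have "J (\<lambda>u. \<Sum>t\<in>F. c t * indicat_real {0<..t} u) = elementary_integrand F c"
      by (rule insert.IH) (use insert.prems in simp)
    ultimately show ?case
      by (simp only: elementary_integrand_def sum.insert[OF insert.hyps] mult_1 scaleR_one)
  qed
qed

lemma elementary_integrand_dense_closure:
  "closure {elementary_integrand F c | F c. finite F \<and> F \<subseteq> {0..T}} = UNIV"
proof -
  have "J ` step_functions T \<subseteq> {elementary_integrand F c | F c. finite F \<and> F \<subseteq> {0..T}}"
    unfolding step_functions_def using J_step_function by blast
  then have "closure (J ` step_functions T) \<subseteq> closure {elementary_integrand F c | F c. finite F \<and> F \<subseteq> {0..T}}"
    by (rule closure_mono)
  moreover have "closure (J ` step_functions T) = UNIV"
    using integrands by (simp add: integrand_space_def)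
  ultimately show ?thesis by auto
qed

lemma elementary_integrand_dense:
  assumes "0 < e"
  obtains F c where "finite F" "F \<subseteq> {0..T}" "norm (f - elementary_integrand F c) < e"
proof -
  have "f \<in> closure {elementary_integrand F c | F c. finite F \<and> F \<subseteq> {0..T}}"
    using elementary_integrand_dense_closure by blast
  with assms obtain F c where "finite F" "F \<subseteq> {0..T}" "dist (elementary_integrand F c) f < e"
    unfolding closure_approachable by blast
  then show thesis by (intro that) (auto simp: dist_norm norm_minus_commute)
qed

text \<open>
  The closure of the graph of the map taking $\sum_t c_t \mathbf 1_{(0,t]}$ to $\sum_t c_t X_t$. The
  integrand and the random variable enter symmetrically: completeness of $L^2$ supplies an integral
  for every integrand, and completeness of the integrands supplies an integrand for every element of
  the first chaos.
\<close>

definition represents :: "'h \<Rightarrow> ('a \<Rightarrow> real) \<Rightarrow> bool" where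
  "represents f \<xi> \<longleftrightarrow> \<xi> \<in> L2_X M T X \<and>
     (\<forall>e>0. \<exists>F c. finite F \<and> F \<subseteq> {0..T} \<and> norm (f - elementary_integrand F c) < e \<and>
        L2_norm M (\<lambda>\<omega>. \<xi> \<omega> - elementary_integral F c \<omega>) < e)"

lemma represents_L2_X: "represents f \<xi> \<Longrightarrow> \<xi> \<in> L2_X M T X"
  by (simp add: represents_def)

lemma represents_square_integrable: "represents f \<xi> \<Longrightarrow> square_integrable M \<xi>"
  by (simp add: represents_def L2_X_iff)

lemma representsE:
  assumes "represents f \<xi>" "0 < e"
  obtains F c where "finite F" "F \<subseteq> {0..T}" "norm (f - elementary_integrand F c) < e"
    "L2_norm M (\<lambda>\<omega>. \<xi> \<omega> - elementary_integral F c \<omega>) < e"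
  using assms unfolding represents_def by blast

lemma represents_elementary:
  assumes "finite F" "F \<subseteq> {0..T}"
  shows "represents (elementary_integrand F c) (elementary_integral F c)"
  unfolding represents_def using assms elementary_integral_L2_X
  by (auto intro!: exI[of _ F] exI[of _ c] simp: L2_norm_zero)

lemma represents_time_integrand:
  assumes "t \<in> {0..T}"
  shows "represents (time_integrand t) (X t)"
  using represents_elementary[of "{t}" "\<lambda>_. 1"] assms
  by (simp add: elementary_integrand_def elementary_integral_def[abs_def])

lemma represents_combination:
  assumes f: "represents f \<xi>" and g: "represents g \<zeta>"
  shows "represents (a *\<^sub>R f + b *\<^sub>R g) (\<lambda>\<omega>. a * \<xi> \<omega> + b * \<zeta> \<omega>)"
  unfolding represents_def
proof (intro conjI allI impI)
  show "(\<lambda>\<omega>. a * \<xi> \<omega> + b * \<zeta> \<omega>) \<in> L2_X M T X"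
    using f g by (intro L2_X_combination represents_L2_X)
  fix e :: real assume "0 < e"
  define d where "d = e / (\<bar>a\<bar> + \<bar>b\<bar> + 1)"
  have d: "0 < d" "(\<bar>a\<bar> + \<bar>b\<bar>) * d < e"
    using \<open>0 < e\<close> by (auto simp: d_def field_simps intro!: divide_pos_pos)
  obtain F c where F: "finite F" "F \<subseteq> {0..T}" "norm (f - elementary_integrand F c) < d"
    "L2_norm M (\<lambda>\<omega>. \<xi> \<omega> - elementary_integral F c \<omega>) < d"
    using representsE[OF f d(1)] .
  obtain G k where G: "finite G" "G \<subseteq> {0..T}" "norm (g - elementary_integrand G k) < d"
    "L2_norm M (\<lambda>\<omega>. \<zeta> \<omega> - elementary_integral G k \<omega>) < d"
    using representsE[OF g d(1)] .
  obtain H l where H: "finite H" "H \<subseteq> {0..T}"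
    "elementary_integrand H l = a *\<^sub>R elementary_integrand F c + b *\<^sub>R elementary_integrand G k"
    "elementary_integral H l = (\<lambda>\<omega>. a * elementary_integral F c \<omega> + b * elementary_integral G k \<omega>)"
    using elementary_combination[OF F(1,2) G(1,2)] .
  have weights: "\<bar>a\<bar> * p + \<bar>b\<bar> * q < e" if "p < d" "q < d" for p q
  proof -
    have "\<bar>a\<bar> * p + \<bar>b\<bar> * q \<le> \<bar>a\<bar> * d + \<bar>b\<bar> * d"
      using that by (intro add_mono mult_left_mono) auto
    then show ?thesis using d(2) by (simp add: distrib_right)
  qed
  have "norm (a *\<^sub>R f + b *\<^sub>R g - elementary_integrand H l)
      = norm (a *\<^sub>R (f - elementary_integrand F c) + b *\<^sub>R (g - elementary_integrand G k))"
    by (simp add: H algebra_simps)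
  also have "\<dots> \<le> \<bar>a\<bar> * norm (f - elementary_integrand F c) + \<bar>b\<bar> * norm (g - elementary_integrand G k)"
    using norm_triangle_ineq[of "a *\<^sub>R (f - elementary_integrand F c)" "b *\<^sub>R (g - elementary_integrand G k)"] by simp
  also have "\<dots> < e" by (rule weights[OF F(3) G(3)])
  finally have 1: "norm (a *\<^sub>R f + b *\<^sub>R g - elementary_integrand H l) < e" .
  have "L2_norm M (\<lambda>\<omega>. a * \<xi> \<omega> + b * \<zeta> \<omega> - elementary_integral H l \<omega>)
      = L2_norm M (\<lambda>\<omega>. a * (\<xi> \<omega> - elementary_integral F c \<omega>) + b * (\<zeta> \<omega> - elementary_integral G k \<omega>))"
    by (simp add: H algebra_simps)
  also have "\<dots> \<le> \<bar>a\<bar> * L2_norm M (\<lambda>\<omega>. \<xi> \<omega> - elementary_integral F c \<omega>)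
      + \<bar>b\<bar> * L2_norm M (\<lambda>\<omega>. \<zeta> \<omega> - elementary_integral G k \<omega>)"
    using f g F G by (intro L2_norm_combination_le square_integrable_diff
        represents_square_integrable elementary_integral_square_integrable)
  also have "\<dots> < e" by (rule weights[OF F(4) G(4)])
  finally have 2: "L2_norm M (\<lambda>\<omega>. a * \<xi> \<omega> + b * \<zeta> \<omega> - elementary_integral H l \<omega>) < e" .
  show "\<exists>F c. finite F \<and> F \<subseteq> {0..T} \<and> norm (a *\<^sub>R f + b *\<^sub>R g - elementary_integrand F c) < e \<and>
        L2_norm M (\<lambda>\<omega>. a * \<xi> \<omega> + b * \<zeta> \<omega> - elementary_integral F c \<omega>) < e"
    using H(1,2) 1 2 by blast
qed

lemma represents_norm:
  assumes "represents f \<xi>"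
  shows "L2_norm M \<xi> = norm f"
proof -
  have "\<bar>L2_norm M \<xi> - norm f\<bar> \<le> 0 + e" if e: "0 < e" for e
  proof -
    obtain F c where F: "finite F" "F \<subseteq> {0..T}" "norm (f - elementary_integrand F c) < e / 2"
      "L2_norm M (\<lambda>\<omega>. \<xi> \<omega> - elementary_integral F c \<omega>) < e / 2"
      using representsE[OF assms half_gt_zero[OF e]] .
    have "\<bar>L2_norm M \<xi> - L2_norm M (elementary_integral F c)\<bar> < e / 2"
      using L2_norm_diff_abs_le[OF represents_square_integrable[OF assms]
          elementary_integral_square_integrable[OF F(2)], of c] F(4) by linarith
    moreover have "\<bar>norm (elementary_integrand F c) - norm f\<bar> < e / 2"
      using norm_triangle_ineq3[of "elementary_integrand F c" f] F(3) by (simp add: norm_minus_commute)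
    ultimately show ?thesis using L2_norm_elementary_integral[OF F(1,2), of c] by linarith
  qed
  then have "\<bar>L2_norm M \<xi> - norm f\<bar> \<le> 0" by (rule field_le_epsilon)
  then show ?thesis by simp
qed

lemma represents_AE_unique:
  assumes "represents f \<xi>" "represents f \<zeta>"
  shows "AE \<omega> in M. \<xi> \<omega> = \<zeta> \<omega>"
proof -
  have rep: "represents 0 (\<lambda>\<omega>. \<xi> \<omega> - \<zeta> \<omega>)"
    using represents_combination[OF assms, of 1 "-1"] by simp
  then have "(\<integral>\<omega>. (\<xi> \<omega> - \<zeta> \<omega>)\<^sup>2 \<partial>M) = 0"
    using represents_norm[OF rep] L2_norm_power2[of M "\<lambda>\<omega>. \<xi> \<omega> - \<zeta> \<omega>"] by simp
  moreover have "integrable M (\<lambda>\<omega>. (\<xi> \<omega> - \<zeta> \<omega>)\<^sup>2)"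
    using represents_square_integrable[OF rep] by (simp add: square_integrable_def)
  ultimately have "AE \<omega> in M. (\<xi> \<omega> - \<zeta> \<omega>)\<^sup>2 = 0"
    using integral_nonneg_eq_0_iff_AE[of M "\<lambda>\<omega>. (\<xi> \<omega> - \<zeta> \<omega>)\<^sup>2"] by simp
  then show ?thesis by simp
qed

lemma represents_inner:
  assumes "represents f \<xi>" "represents g \<zeta>"
  shows "(\<integral>\<omega>. \<xi> \<omega> * \<zeta> \<omega> \<partial>M) = f \<bullet> g"
proof -
  have "(norm (f + g))\<^sup>2 = (norm f)\<^sup>2 + (norm g)\<^sup>2 + 2 * (\<integral>\<omega>. \<xi> \<omega> * \<zeta> \<omega> \<partial>M)"
    using L2_norm_combination_power2[OF assms[THEN represents_square_integrable], of 1 1]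
      represents_norm[OF represents_combination[OF assms, of 1 1]] assms[THEN represents_norm]
    by simp
  then show ?thesis by (simp add: power2_norm_eq_inner inner_add_left inner_add_right inner_commute)
qed

lemma represents_char:
  assumes "represents f \<xi>"
  shows "char (distr M borel \<xi>) t = of_real (exp (- (t * norm f)\<^sup>2 / 2))"
proof -
  have "\<forall>n. \<exists>F c. finite F \<and> F \<subseteq> {0..T} \<and> norm (f - elementary_integrand F c) < 1 / real (Suc n)
      \<and> L2_norm M (\<lambda>\<omega>. \<xi> \<omega> - elementary_integral F c \<omega>) < 1 / real (Suc n)"
    using assms unfolding represents_def by simp
  then obtain F c where F: "\<And>n. finite (F n)" "\<And>n. F n \<subseteq> {0..T}"
      "\<And>n. norm (f - elementary_integrand (F n) (c n)) < 1 / real (Suc n)"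
      "\<And>n. L2_norm M (\<lambda>\<omega>. \<xi> \<omega> - elementary_integral (F n) (c n) \<omega>) < 1 / real (Suc n)"
    by metis
  have inv: "(\<lambda>n. 1 / real (Suc n)) \<longlonglongrightarrow> 0"
    using LIMSEQ_inverse_real_of_nat by (simp add: inverse_eq_divide)
  have "(\<lambda>n. f - elementary_integrand (F n) (c n)) \<longlonglongrightarrow> 0"
    by (rule Lim_null_comparison[OF _ inv]) (intro always_eventually allI less_imp_le F(3))
  then have "(\<lambda>n. f - (f - elementary_integrand (F n) (c n))) \<longlonglongrightarrow> f - 0"
    by (intro tendsto_intros)
  then have "(\<lambda>n. elementary_integrand (F n) (c n)) \<longlonglongrightarrow> f" by simp
  then have "(\<lambda>n. complex_of_real (exp (- (t * norm (elementary_integrand (F n) (c n)))\<^sup>2 / 2)))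
      \<longlonglongrightarrow> of_real (exp (- (t * norm f)\<^sup>2 / 2))"
    by (intro tendsto_intros) auto
  then have 1: "(\<lambda>n. char (distr M borel (elementary_integral (F n) (c n))) t)
      \<longlonglongrightarrow> of_real (exp (- (t * norm f)\<^sup>2 / 2))"
    by (simp only: char_elementary_integral[OF F(1,2)])
  have "(\<lambda>n. char (distr M borel \<xi>) t - char (distr M borel (elementary_integral (F n) (c n))) t) \<longlonglongrightarrow> 0"
  proof (rule Lim_null_comparison)
    show "(\<lambda>n. \<bar>t\<bar> * (1 / real (Suc n))) \<longlonglongrightarrow> 0" using tendsto_mult_left[OF inv, of "\<bar>t\<bar>"] by simp
    show "\<forall>\<^sub>F n in sequentially. norm (char (distr M borel \<xi>) t
        - char (distr M borel (elementary_integral (F n) (c n))) t) \<le> \<bar>t\<bar> * (1 / real (Suc n))"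
    proof (intro always_eventually allI)
      fix n
      have "norm (char (distr M borel \<xi>) t - char (distr M borel (elementary_integral (F n) (c n))) t)
          \<le> \<bar>t\<bar> * L2_norm M (\<lambda>\<omega>. \<xi> \<omega> - elementary_integral (F n) (c n) \<omega>)"
        by (intro char_dist_le_L2_norm represents_square_integrable[OF assms]
            elementary_integral_square_integrable F(2))
      also have "\<dots> \<le> \<bar>t\<bar> * (1 / real (Suc n))"
        by (rule mult_left_mono[OF less_imp_le[OF F(4)]]) simp
      finally show "norm (char (distr M borel \<xi>) t - char (distr M borel (elementary_integral (F n) (c n))) t)
          \<le> \<bar>t\<bar> * (1 / real (Suc n))" .
    qed
  qed
  from tendsto_add[OF this 1] have lim: "(\<lambda>n::nat. char (distr M borel \<xi>) t)
      \<longlonglongrightarrow> of_real (exp (- (t * norm f)\<^sup>2 / 2))" by simp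
  then show ?thesis by (simp add: LIMSEQ_const_iff)
qed

lemma L2_norm_elementary_diff:
  assumes "finite F" "F \<subseteq> {0..T}" "finite G" "G \<subseteq> {0..T}"
  shows "L2_norm M (\<lambda>\<omega>. elementary_integral F c \<omega> - elementary_integral G d \<omega>)
    = norm (elementary_integrand F c - elementary_integrand G d)"
  using represents_norm[OF represents_combination[OF represents_elementary[OF assms(1,2), of c]
        represents_elementary[OF assms(3,4), of d], of 1 "-1"]] by simp

lemma represents_integral_exists: "\<exists>\<xi>. represents f \<xi>"
proof -
  have "\<forall>n. \<exists>F c. finite F \<and> F \<subseteq> {0..T} \<and> norm (f - elementary_integrand F c) < 1 / real (Suc n)"
  proof
    fix n :: nat
    have "0 < 1 / real (Suc n)" by simp
    then show "\<exists>F c. finite F \<and> F \<subseteq> {0..T} \<and> norm (f - elementary_integrand F c) < 1 / real (Suc n)"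
      using elementary_integrand_dense[of "1 / real (Suc n)" f] by metis
  qed
  then obtain F c where F: "\<And>n. finite (F n)" "\<And>n. F n \<subseteq> {0..T}"
      "\<And>n. norm (f - elementary_integrand (F n) (c n)) < 1 / real (Suc n)"
    by metis
  have small: "\<exists>N. \<forall>n\<ge>N. norm (f - elementary_integrand (F n) (c n)) < e" if "0 < e" for e :: real
  proof -
    obtain N where N: "inverse (real (Suc N)) < e" using reals_Archimedean[OF \<open>0 < e\<close>] by auto
    have "norm (f - elementary_integrand (F n) (c n)) < e" if "N \<le> n" for n
    proof -
      have "1 / real (Suc n) \<le> inverse (real (Suc N))" using that by (simp add: field_simps)
      then show ?thesis using F(3)[of n] N by linarith
    qed
    then show ?thesis by blast
  qed
  obtain \<xi> where \<xi>: "\<xi> \<in> borel_measurable (natural_filtration M X T)" "square_integrable M \<xi>"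
    "(\<lambda>n. L2_norm M (\<lambda>\<omega>. elementary_integral (F n) (c n) \<omega> - \<xi> \<omega>)) \<longlonglongrightarrow> 0"
  proof (rule L2_complete[of "natural_filtration M X T" "\<lambda>n. elementary_integral (F n) (c n)"])
    show "subalgebra M (natural_filtration M X T)" by (rule natural_filtration_subalgebra) simp
    show "elementary_integral (F n) (c n) \<in> borel_measurable (natural_filtration M X T)"
      "square_integrable M (elementary_integral (F n) (c n))" for n
      using elementary_integral_L2_X[OF F(2)] unfolding L2_X_iff by auto
    fix e :: real assume "0 < e"
    then obtain N where N: "\<And>n. n \<ge> N \<Longrightarrow> norm (f - elementary_integrand (F n) (c n)) < e / 2"
      using small[of "e / 2"] by auto
    have "L2_norm M (\<lambda>\<omega>. elementary_integral (F m) (c m) \<omega> - elementary_integral (F n) (c n) \<omega>) < e"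
      if "N \<le> m" "N \<le> n" for m n
    proof -
      have "norm (elementary_integrand (F m) (c m) - elementary_integrand (F n) (c n)) < e"
        using norm_triangle_half_l[of "elementary_integrand (F m) (c m)" f e "elementary_integrand (F n) (c n)"]
          N[OF that(1)] N[OF that(2)] by (simp add: norm_minus_commute)
      then show ?thesis by (simp add: L2_norm_elementary_diff[OF F(1,2) F(1,2)])
    qed
    then show "\<exists>N. \<forall>m\<ge>N. \<forall>n\<ge>N.
        L2_norm M (\<lambda>\<omega>. elementary_integral (F m) (c m) \<omega> - elementary_integral (F n) (c n) \<omega>) < e" by blast
  qed
  have rep: "represents f \<xi>"
    unfolding represents_def
  proof (intro conjI allI impI)
    show "\<xi> \<in> L2_X M T X" using \<xi> by (simp add: L2_X_iff)
    fix e :: real assume "0 < e"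
    obtain N where N: "\<And>n. n \<ge> N \<Longrightarrow> norm (f - elementary_integrand (F n) (c n)) < e"
      using small[OF \<open>0 < e\<close>] by auto
    obtain K where K: "\<And>n. n \<ge> K \<Longrightarrow> L2_norm M (\<lambda>\<omega>. elementary_integral (F n) (c n) \<omega> - \<xi> \<omega>) < e"
      using LIMSEQ_D[OF \<xi>(3) \<open>0 < e\<close>] by (auto simp: L2_norm_nonneg)
    show "\<exists>F c. finite F \<and> F \<subseteq> {0..T} \<and> norm (f - elementary_integrand F c) < e \<and>
        L2_norm M (\<lambda>\<omega>. \<xi> \<omega> - elementary_integral F c \<omega>) < e"
      using F(1,2) N[of "max N K"] K[of "max N K"] by (metis L2_norm_minus_commute max.cobounded1 max.cobounded2)
  qed
  then show ?thesis by (rule exI[where x = \<xi>])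
qed

lemma first_chaos_iff:
  "h \<in> first_chaos M T X \<longleftrightarrow> h \<in> L2_X M T X \<and>
    (\<forall>e>0. \<exists>F c. finite F \<and> F \<subseteq> {0..T} \<and> L2_norm M (\<lambda>\<omega>. h \<omega> - elementary_integral F c \<omega>) < e)"
proof -
  have "(\<forall>e>0. \<exists>F c. finite F \<and> F \<subseteq> {0..T} \<and> (L2_norm M (\<lambda>\<omega>. h \<omega> - elementary_integral F c \<omega>))\<^sup>2 < e)
    \<longleftrightarrow> (\<forall>e>0. \<exists>F c. finite F \<and> F \<subseteq> {0..T} \<and> L2_norm M (\<lambda>\<omega>. h \<omega> - elementary_integral F c \<omega>) < e)"
    (is "?A \<longleftrightarrow> ?B")
  proof
    assume ?A
    show ?B
    proof (intro allI impI)
      fix e :: real assume "0 < e"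
      then have "0 < e\<^sup>2" by simp
      with \<open>?A\<close> obtain F c where "finite F" "F \<subseteq> {0..T}"
        "(L2_norm M (\<lambda>\<omega>. h \<omega> - elementary_integral F c \<omega>))\<^sup>2 < e\<^sup>2" by blast
      moreover from this(3) have "L2_norm M (\<lambda>\<omega>. h \<omega> - elementary_integral F c \<omega>) < e"
        using \<open>0 < e\<close> by (simp add: power_less_imp_less_base)
      ultimately show "\<exists>F c. finite F \<and> F \<subseteq> {0..T} \<and> L2_norm M (\<lambda>\<omega>. h \<omega> - elementary_integral F c \<omega>) < e"
        by blast
    qed
  next
    assume ?B
    show ?A
    proof (intro allI impI)
      fix e :: real assume "0 < e"
      then have "0 < sqrt e" by simp
      with \<open>?B\<close> obtain F c where "finite F" "F \<subseteq> {0..T}"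
        "L2_norm M (\<lambda>\<omega>. h \<omega> - elementary_integral F c \<omega>) < sqrt e" by blast
      moreover from this(3) have "(L2_norm M (\<lambda>\<omega>. h \<omega> - elementary_integral F c \<omega>))\<^sup>2 < e"
        unfolding L2_norm_power2 by (simp add: L2_norm_def)
      ultimately show "\<exists>F c. finite F \<and> F \<subseteq> {0..T} \<and> (L2_norm M (\<lambda>\<omega>. h \<omega> - elementary_integral F c \<omega>))\<^sup>2 < e"
        by blast
    qed
  qed
  then show ?thesis unfolding first_chaos_def L2_norm_power2 elementary_integral_def by simp
qed

lemma represents_imp_first_chaos: "represents f \<xi> \<Longrightarrow> \<xi> \<in> first_chaos M T X"
  unfolding first_chaos_iff represents_def by blast

lemma represents_integrand_exists:
  assumes "h \<in> first_chaos M T X"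
  shows "\<exists>g. represents g h"
proof -
  have hL2: "h \<in> L2_X M T X" and "\<forall>n. \<exists>F c. finite F \<and> F \<subseteq> {0..T}
      \<and> L2_norm M (\<lambda>\<omega>. h \<omega> - elementary_integral F c \<omega>) < 1 / real (Suc n)"
    using assms by (auto simp: first_chaos_iff)
  then obtain F c where F: "\<And>n. finite (F n)" "\<And>n. F n \<subseteq> {0..T}"
      "\<And>n. L2_norm M (\<lambda>\<omega>. h \<omega> - elementary_integral (F n) (c n) \<omega>) < 1 / real (Suc n)"
    by metis
  have h: "square_integrable M h" using hL2 by (simp add: L2_X_iff)
  have small: "\<exists>N. \<forall>n\<ge>N. L2_norm M (\<lambda>\<omega>. h \<omega> - elementary_integral (F n) (c n) \<omega>) < e" if "0 < e" for e :: real
  proof -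
    obtain N where N: "inverse (real (Suc N)) < e" using reals_Archimedean[OF \<open>0 < e\<close>] by auto
    have "L2_norm M (\<lambda>\<omega>. h \<omega> - elementary_integral (F n) (c n) \<omega>) < e" if "N \<le> n" for n
    proof -
      have "1 / real (Suc n) \<le> inverse (real (Suc N))" using that by (simp add: field_simps)
      then show ?thesis using F(3)[of n] N by linarith
    qed
    then show ?thesis by blast
  qed
  have "Cauchy (\<lambda>n. elementary_integrand (F n) (c n))"
  proof (rule CauchyI)
    fix e :: real assume "0 < e"
    then obtain N where N: "\<And>n. n \<ge> N \<Longrightarrow> L2_norm M (\<lambda>\<omega>. h \<omega> - elementary_integral (F n) (c n) \<omega>) < e / 2"
      using small[of "e / 2"] by auto
    have "norm (elementary_integrand (F m) (c m) - elementary_integrand (F n) (c n)) < e"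
      if "N \<le> m" "N \<le> n" for m n
    proof -
      have "L2_norm M (\<lambda>\<omega>. elementary_integral (F m) (c m) \<omega> - elementary_integral (F n) (c n) \<omega>)
          \<le> L2_norm M (\<lambda>\<omega>. elementary_integral (F m) (c m) \<omega> - h \<omega>)
            + L2_norm M (\<lambda>\<omega>. h \<omega> - elementary_integral (F n) (c n) \<omega>)"
        by (intro L2_norm_triangle h elementary_integral_square_integrable F(2))
      then show ?thesis
        using N[OF that(1)] N[OF that(2)] L2_norm_minus_commute[of M h "elementary_integral (F m) (c m)"]
        by (simp add: L2_norm_elementary_diff[OF F(1,2) F(1,2)])
    qed
    then show "\<exists>N. \<forall>m\<ge>N. \<forall>n\<ge>N. norm (elementary_integrand (F m) (c m) - elementary_integrand (F n) (c n)) < e"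
      by blast
  qed
  then obtain g where g: "(\<lambda>n. elementary_integrand (F n) (c n)) \<longlonglongrightarrow> g"
    using Cauchy_convergent_iff convergent_def by blast
  have "represents g h"
    unfolding represents_def
  proof (intro conjI allI impI hL2)
    fix e :: real assume "0 < e"
    obtain N where N: "\<And>n. n \<ge> N \<Longrightarrow> L2_norm M (\<lambda>\<omega>. h \<omega> - elementary_integral (F n) (c n) \<omega>) < e"
      using small[OF \<open>0 < e\<close>] by auto
    obtain K where K: "\<And>n. n \<ge> K \<Longrightarrow> norm (elementary_integrand (F n) (c n) - g) < e"
      using LIMSEQ_D[OF g \<open>0 < e\<close>] by auto
    show "\<exists>F c. finite F \<and> F \<subseteq> {0..T} \<and> norm (g - elementary_integrand F c) < e \<and>
        L2_norm M (\<lambda>\<omega>. h \<omega> - elementary_integral F c \<omega>) < e"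
      using F(1,2) N[of "max N K"] K[of "max N K"] by (metis norm_minus_commute max.cobounded1 max.cobounded2)
  qed
  then show ?thesis by (rule exI)
qed

lemma wiener_integral_exists: "\<exists>I. is_wiener_integral M T X J I"
proof -
  define I where "I f = (SOME \<xi>. represents f \<xi>)" for f
  have I: "represents f (I f)" for f
    unfolding I_def by (rule someI_ex[OF represents_integral_exists])
  have "is_wiener_integral M T X J I"
    unfolding is_wiener_integral_def
  proof (intro conjI allI ballI)
    show "I g \<in> first_chaos M T X" for g by (rule represents_imp_first_chaos[OF I])
    show "AE \<omega> in M. I (a *\<^sub>R f + b *\<^sub>R g) \<omega> = a * I f \<omega> + b * I g \<omega>" for f g a b
      by (rule represents_AE_unique[OF I represents_combination[OF I I]])
    show "(\<integral>\<omega>. I f \<omega> * I g \<omega> \<partial>M) = f \<bullet> g" for f g by (rule represents_inner[OF I I])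
    show "AE \<omega> in M. I (time_integrand t) \<omega> = X t \<omega>" if "t \<in> {0..T}" for t
      by (rule represents_AE_unique[OF I represents_time_integrand[OF that]])
  qed
  then show ?thesis by (rule exI[where x = I])
qed

text \<open>
  The defining properties of a Wiener integral determine it on finite sums, and the isometry turns
  approximation of an integrand into approximation of its integral.
\<close>

lemma wiener_integral_represents: "represents f (wiener_integral M T X J f)"
proof -
  define I where "I = wiener_integral M T X J"
  have "is_wiener_integral M T X J I"
    unfolding I_def wiener_integral_def by (rule someI_ex[OF wiener_integral_exists])
  then have chaos: "I f \<in> first_chaos M T X"
    and lin: "AE \<omega> in M. I (a *\<^sub>R f + b *\<^sub>R g) \<omega> = a * I f \<omega> + b * I g \<omega>"
    and iso: "(\<integral>\<omega>. I f \<omega> * I g \<omega> \<partial>M) = f \<bullet> g"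
    and IX: "t \<in> {0..T} \<Longrightarrow> AE \<omega> in M. I (time_integrand t) \<omega> = X t \<omega>" for f g a b t
    unfolding is_wiener_integral_def by blast+
  have I_L2_X: "I f \<in> L2_X M T X" for f using chaos[of f] by (simp add: first_chaos_iff)
  then have [measurable]: "I f \<in> borel_measurable M" for f by (simp add: L2_X_iff square_integrable_def)
  have simple: "AE \<omega> in M. I (elementary_integrand F c) \<omega> = elementary_integral F c \<omega>"
    if "finite F" "F \<subseteq> {0..T}" for F c
    using that
  proof (induction F rule: finite_induct)
    case empty
    then show ?case using lin[of 0 0 0 0] by (simp add: elementary_integrand_def elementary_integral_def)
  next
    case (insert t F)
    then have "AE \<omega> in M. I (elementary_integrand F c) \<omega> = elementary_integral F c \<omega>" by simp
    moreover have "AE \<omega> in M. I (time_integrand t) \<omega> = X t \<omega>" using insert.prems by (intro IX) simp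
    moreover have "elementary_integrand (insert t F) c = c t *\<^sub>R time_integrand t + 1 *\<^sub>R elementary_integrand F c"
      using insert.hyps by (simp add: elementary_integrand_def)
    moreover note lin[of "c t" "time_integrand t" 1 "elementary_integrand F c"]
    ultimately show ?case using insert.hyps by (auto simp: elementary_integral_def)
  qed
  have "represents f (I f)" for f
    unfolding represents_def
  proof (intro conjI allI impI I_L2_X)
    fix e :: real assume "0 < e"
    obtain F c where F: "finite F" "F \<subseteq> {0..T}" "norm (f - elementary_integrand F c) < e"
      by (rule elementary_integrand_dense[OF \<open>0 < e\<close>])
    have [measurable]: "elementary_integral F c \<in> borel_measurable M"
      using elementary_integral_square_integrable[OF F(2)] by (simp add: square_integrable_def)
    have "(L2_norm M (\<lambda>\<omega>. I f \<omega> - elementary_integral F c \<omega>))\<^sup>2 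
        = (\<integral>\<omega>. I (f - elementary_integrand F c) \<omega> * I (f - elementary_integrand F c) \<omega> \<partial>M)"
      unfolding L2_norm_power2
    proof (rule integral_cong_AE)
      show "AE \<omega> in M. (I f \<omega> - elementary_integral F c \<omega>)\<^sup>2
          = I (f - elementary_integrand F c) \<omega> * I (f - elementary_integrand F c) \<omega>"
        using simple[OF F(1,2), of c] lin[of 1 f "-1" "elementary_integrand F c"]
        by eventually_elim (simp add: power2_eq_square)
    qed measurable
    also have "\<dots> = (norm (f - elementary_integrand F c))\<^sup>2" by (simp add: iso power2_norm_eq_inner)
    finally have "L2_norm M (\<lambda>\<omega>. I f \<omega> - elementary_integral F c \<omega>) < e"
      using F(3) by (simp add: L2_norm_nonneg)
    with F show "\<exists>F c. finite F \<and> F \<subseteq> {0..T} \<and> norm (f - elementary_integrand F c) < e \<and>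
        L2_norm M (\<lambda>\<omega>. I f \<omega> - elementary_integral F c \<omega>) < e" by blast
  qed
  then show ?thesis by (simp add: I_def)
qed

end

context gaussian_integrands
begin

abbreviation wiener :: "'h \<Rightarrow> 'a \<Rightarrow> real" where
  "wiener \<equiv> wiener_integral M T X J"

sublocale isonormal_family M wiener
proof
  show "wiener f \<in> borel_measurable M" for f
    using represents_square_integrable[OF wiener_integral_represents] by (simp add: square_integrable_def)
  show "AE \<omega> in M. wiener (a *\<^sub>R f + b *\<^sub>R g) \<omega> = a * wiener f \<omega> + b * wiener g \<omega>" for a b f g
    by (rule represents_AE_unique[OF wiener_integral_represents
          represents_combination[OF wiener_integral_represents wiener_integral_represents]])
  show "char (distr M borel (wiener f)) t = of_real (exp (- (t * norm f)\<^sup>2 / 2))" for f t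
    by (rule represents_char[OF wiener_integral_represents])
qed

lemma represents_AE_wiener: "represents f \<xi> \<Longrightarrow> AE \<omega> in M. \<xi> \<omega> = wiener f \<omega>"
  by (rule represents_AE_unique[OF _ wiener_integral_represents])

section \<open>The S-transform\<close>

lemma S_transform_eq:
  "S_transform M T X J \<xi> f = exp (- (norm f)\<^sup>2 / 2) * (\<integral>\<omega>. \<xi> \<omega> * exp (wiener f \<omega>) \<partial>M)"
proof -
  have "(\<integral>\<omega>. (wiener f \<omega>)\<^sup>2 \<partial>M) = (norm f)\<^sup>2"
    using represents_norm[OF wiener_integral_represents, of f] L2_norm_power2[of M "wiener f"] by simp
  then have "wick_exp M (wiener f) \<omega> = exp (- (norm f)\<^sup>2 / 2) * exp (wiener f \<omega>)" for \<omega>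
    by (simp add: wick_exp_def exp_add[symmetric])
  then have "\<xi> \<omega> * wick_exp M (wiener f) \<omega> = exp (- (norm f)\<^sup>2 / 2) * (\<xi> \<omega> * exp (wiener f \<omega>))" for \<omega>
    by simp
  then show ?thesis unfolding S_transform_def by (simp only: integral_mult_right_zero)
qed

text \<open>
  On the first chaos the $S$-transform is the inner product with the integrand: the normalisation of
  the Wick exponential cancels the factor $e^{\|f\|^2/2}$ of \<open>integral_W_exp_W\<close>.
\<close>

lemma S_transform_represents:
  assumes "represents g h"
  shows "S_transform M T X J h f = g \<bullet> f"
proof -
  have [measurable]: "h \<in> borel_measurable M"
    using represents_square_integrable[OF assms] by (simp add: square_integrable_def)
  have "(\<integral>\<omega>. h \<omega> * exp (wiener f \<omega>) \<partial>M) = (\<integral>\<omega>. wiener g \<omega> * exp (wiener f \<omega>) \<partial>M)"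
    by (rule integral_cong_AE, measurable) (use represents_AE_wiener[OF assms] in \<open>auto elim: eventually_mono\<close>)
  then show ?thesis
    by (simp add: S_transform_eq integral_W_exp_W exp_minus)
qed

lemma natural_filtration_cond_exp: "r \<le> T \<Longrightarrow> finite_measure_subalgebra M (natural_filtration M X r)"
  using natural_filtration_subalgebra
  by (intro finite_measure_subalgebra.intro finite_measure_subalgebra_axioms.intro finite_measure_axioms)

text \<open>
  The difference of the two variables has integral $0$ over every event of the terminal
  $\sigma$-algebra, so its conditional expectation vanishes; being measurable, the difference agrees
  with that conditional expectation.
\<close>

theorem S_transform_injective:
  assumes \<xi>: "\<xi> \<in> L2_X M T X" and \<zeta>: "\<zeta> \<in> L2_X M T X"
    and S: "\<And>f. S_transform M T X J \<xi> f = S_transform M T X J \<zeta> f"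
  shows "AE \<omega> in M. \<xi> \<omega> = \<zeta> \<omega>"
proof -
  interpret C: finite_measure_subalgebra M "natural_filtration M X T"
    by (rule natural_filtration_cond_exp) simp
  define \<delta> where "\<delta> \<omega> = \<xi> \<omega> - \<zeta> \<omega>" for \<omega>
  have \<delta>: "square_integrable M \<delta>" "\<delta> \<in> borel_measurable (natural_filtration M X T)"
    using L2_X_combination[OF \<xi> \<zeta>, of 1 "-1"] unfolding L2_X_iff \<delta>_def by simp_all
  have int: "integrable M (\<lambda>\<omega>. \<nu> \<omega> * exp (wiener f \<omega>))" if "\<nu> \<in> L2_X M T X" for \<nu> f
    using that by (intro square_integrable_mult square_integrable_exp_W) (simp add: L2_X_iff)
  have laplace: "(\<integral>\<omega>. \<delta> \<omega> * exp (wiener f \<omega>) \<partial>M) = 0" for f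
    using S[of f] int[OF \<xi>, of f] int[OF \<zeta>, of f] by (simp add: S_transform_eq \<delta>_def left_diff_distrib)
  have "(\<integral>\<omega>\<in>A. \<delta> \<omega> \<partial>M) = 0" if "A \<in> sets (natural_filtration M X T)" for A
  proof (rule laplace_null_imp_null_on_sigma_algebra[where V = UNIV and S = "{0..T}" and Y = X and v = time_integrand])
    show "A \<in> sigma_sets (space M) {X s -` B \<inter> space M |s B. s \<in> {0..T} \<and> B \<in> sets borel}"
      using that by (simp only: sets_natural_filtration)
    show "AE \<omega> in M. X s \<omega> = wiener (time_integrand s) \<omega>" if "s \<in> {0..T}" for s
      by (rule represents_AE_wiener[OF represents_time_integrand[OF that]])
  qed (use \<delta> laplace X_measurable in auto)
  then have "AE \<omega> in M. real_cond_exp M (natural_filtration M X T) \<delta> \<omega> = 0"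
    by (intro C.real_cond_exp_charact) (use square_integrable_imp_integrable[OF \<delta>(1)] in auto)
  moreover have "AE \<omega> in M. real_cond_exp M (natural_filtration M X T) \<delta> \<omega> = \<delta> \<omega>"
    by (intro C.real_cond_exp_F_meas square_integrable_imp_integrable \<delta>)
  ultimately show ?thesis unfolding \<delta>_def by eventually_elim simp
qed

end

section \<open>Quasi-conditional expectations on the first chaos\<close>

locale indefinite_gaussian_integrands = gaussian_integrands M T X J
  for M :: "'a measure" and T X and J :: "(real \<Rightarrow> real) \<Rightarrow> 'h::{real_inner, complete_space}" +
  assumes indefinite: "has_indefinite_wiener_integral T J"
begin

text \<open>
  The operator $\mathbb I_r$ of the indefinite Wiener integral.
\<close>

abbreviation trunc :: "real \<Rightarrow> 'h \<Rightarrow> 'h" where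
  "trunc r \<equiv> indefinite_op T J r"

lemma trunc_indefinite_op:
  assumes "r \<in> {0..T}"
  shows "is_indefinite_op T J r (trunc r)"
proof -
  have "\<exists>L. is_indefinite_op T J r L"
    using indefinite assms by (simp add: has_indefinite_wiener_integral_def)
  then show ?thesis unfolding indefinite_op_def by (rule someI_ex)
qed

lemma trunc_bounded_linear: "r \<in> {0..T} \<Longrightarrow> bounded_linear (trunc r)"
  using trunc_indefinite_op by (simp add: is_indefinite_op_def)

lemma trunc_time_integrand:
  "r \<in> {0..T} \<Longrightarrow> t \<in> {0..T} \<Longrightarrow> trunc r (time_integrand t) = time_integrand (min t r)"
  using trunc_indefinite_op by (simp add: is_indefinite_op_def)

text \<open>
  Moving $\mathbb I_r^*$ across the inner product shows that the Wiener integral of $\mathbb I_r g$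
  qualifies; injectivity of the $S$-transform shows that whatever is chosen agrees with it.
\<close>

lemma quasi_cond_exp_represents:
  assumes r: "r \<in> {0..T}" and h: "represents g h"
  shows "AE \<omega> in M. quasi_cond_exp M T X J r h \<omega> = wiener (trunc r g) \<omega>"
    and "quasi_cond_exp M T X J r h \<in> L2_X M T X"
proof -
  have S_wiener: "S_transform M T X J (wiener (trunc r g)) f
      = S_transform M T X J h (restricted_integrand T J r f)" for f
    unfolding restricted_integrand_def S_transform_represents[OF h]
      S_transform_represents[OF wiener_integral_represents]
    by (rule adjoint_works_complete[OF trunc_bounded_linear[OF r]])
  have "is_quasi_cond_exp M T X J r h (wiener (trunc r g))"
    unfolding is_quasi_cond_exp_def using S_wiener wiener_integral_represents represents_L2_X by metis
  then have q: "is_quasi_cond_exp M T X J r h (quasi_cond_exp M T X J r h)"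
    unfolding quasi_cond_exp_def by (rule someI[where P = "is_quasi_cond_exp M T X J r h"])
  then show L2: "quasi_cond_exp M T X J r h \<in> L2_X M T X" by (simp add: is_quasi_cond_exp_def)
  show "AE \<omega> in M. quasi_cond_exp M T X J r h \<omega> = wiener (trunc r g) \<omega>"
  proof (rule S_transform_injective[OF L2 represents_L2_X[OF wiener_integral_represents]])
    show "S_transform M T X J (quasi_cond_exp M T X J r h) f = S_transform M T X J (wiener (trunc r g)) f" for f
      using q unfolding is_quasi_cond_exp_def S_wiener by simp
  qed
qed

lemma second_moment_quasi_cond_exp:
  assumes r: "r \<in> {0..T}" and h: "represents g h"
  shows "(\<integral>\<omega>. (quasi_cond_exp M T X J r h \<omega>)\<^sup>2 \<partial>M) = (norm (trunc r g))\<^sup>2"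
proof -
  have [measurable]: "quasi_cond_exp M T X J r h \<in> borel_measurable M"
    using quasi_cond_exp_represents(2)[OF r h] by (simp add: L2_X_iff square_integrable_def)
  have "(\<integral>\<omega>. (quasi_cond_exp M T X J r h \<omega>)\<^sup>2 \<partial>M) = (\<integral>\<omega>. (wiener (trunc r g) \<omega>)\<^sup>2 \<partial>M)"
    by (rule integral_cong_AE, measurable)
       (use quasi_cond_exp_represents(1)[OF r h] in \<open>auto elim: eventually_mono\<close>)
  also have "\<dots> = (norm (trunc r g))\<^sup>2"
    using represents_norm[OF wiener_integral_represents] by (simp add: L2_norm_power2[symmetric])
  finally show ?thesis .
qed

lemma second_moment_increases_iff:
  "(\<exists>h\<in>first_chaos M T X. \<exists>r\<in>{0..T}.
      (\<integral>\<omega>. (quasi_cond_exp M T X J r h \<omega>)\<^sup>2 \<partial>M) > (\<integral>\<omega>. (h \<omega>)\<^sup>2 \<partial>M))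
    \<longleftrightarrow> (\<exists>r\<in>{0..T}. \<exists>g. norm (trunc r g) > norm g)"
proof -
  have moments: "(\<integral>\<omega>. (quasi_cond_exp M T X J r h \<omega>)\<^sup>2 \<partial>M) > (\<integral>\<omega>. (h \<omega>)\<^sup>2 \<partial>M)
      \<longleftrightarrow> norm (trunc r g) > norm g" if "r \<in> {0..T}" "represents g h" for r g h
  proof -
    have "(\<integral>\<omega>. (h \<omega>)\<^sup>2 \<partial>M) = (norm g)\<^sup>2"
      by (simp only: L2_norm_power2[symmetric] represents_norm[OF that(2)])
    then show ?thesis
      unfolding second_moment_quasi_cond_exp[OF that]
      by (simp add: abs_le_square_iff[symmetric] not_le[symmetric])
  qed
  show ?thesis
    using moments represents_integrand_exists represents_imp_first_chaos wiener_integral_represents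
    by (metis (no_types, lifting))
qed

section \<open>The martingale property\<close>

lemma martingale_imp_increments_orthogonal:
  assumes mart: "martingale_own_filtration M T X"
    and u: "0 \<le> u" "u \<le> r" and t: "r \<le> t" "t \<le> T"
  shows "(time_integrand t - time_integrand r) \<bullet> time_integrand u = 0"
proof -
  have in_T: "u \<in> {0..T}" "r \<in> {0..T}" "t \<in> {0..T}" using u t by auto
  note [measurable] = in_T[THEN X_measurable]
  interpret C: finite_measure_subalgebra M "natural_filtration M X r"
    by (rule natural_filtration_cond_exp) (use t in simp)
  have "AE \<omega> in M. real_cond_exp M (natural_filtration M X r) (X t) \<omega> = X r \<omega>"
    using mart u t unfolding martingale_own_filtration_def by simp
  then have "(\<integral>\<omega>. X u \<omega> * real_cond_exp M (natural_filtration M X r) (X t) \<omega> \<partial>M) = (\<integral>\<omega>. X u \<omega> * X r \<omega> \<partial>M)"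
    by (intro integral_cong_AE) (auto elim: eventually_mono)
  moreover have "(\<integral>\<omega>. X u \<omega> * real_cond_exp M (natural_filtration M X r) (X t) \<omega> \<partial>M) = (\<integral>\<omega>. X u \<omega> * X t \<omega> \<partial>M)"
    by (intro C.real_cond_exp_intg(2) square_integrable_mult X_square_integrable in_T X_adapted u) measurable
  ultimately show ?thesis
    using in_T by (simp add: inner_diff_left inner_time_integrand mult.commute)
qed

text \<open>
  On step functions $g - \mathbb I_r g$ is a combination of increments after time \<open>r\<close>, hence
  orthogonal to $\mathbb I_r g$, and Pythagoras gives the bound. It extends by density.
\<close>

lemma martingale_imp_trunc_contraction:
  assumes mart: "martingale_own_filtration M T X" and r: "r \<in> {0..T}"
  shows "norm (trunc r g) \<le> norm g"
proof -
  interpret L: bounded_linear "trunc r" by (rule trunc_bounded_linear[OF r])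
  have "norm (trunc r (elementary_integrand F c)) \<le> norm (elementary_integrand F c)"
    if F: "finite F" "F \<subseteq> {0..T}" for F c
  proof -
    define f where "f = elementary_integrand F c"
    have trunc_f: "trunc r f = (\<Sum>t\<in>F. c t *\<^sub>R time_integrand (min t r))"
      unfolding f_def elementary_integrand_def using F r
      by (auto simp: L.sum L.scaleR trunc_time_integrand subset_iff intro!: sum.cong)
    have "(time_integrand t - time_integrand (min t r)) \<bullet> time_integrand (min s r) = 0"
      if "t \<in> F" "s \<in> F" for s t
    proof (cases "t \<le> r")
      case False
      then show ?thesis
        using martingale_imp_increments_orthogonal[OF mart, of "min s r" r t] that F r
        by (auto simp: subset_iff min_def)
    qed (simp add: min_def)
    moreover have "f - trunc r f = (\<Sum>t\<in>F. c t *\<^sub>R (time_integrand t - time_integrand (min t r)))"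
      unfolding trunc_f unfolding f_def elementary_integrand_def
      by (simp only: sum_subtractf scaleR_diff_right)
    ultimately have "(f - trunc r f) \<bullet> trunc r f = 0"
      unfolding trunc_f by (simp add: inner_sum_left inner_sum_right)
    then have "(norm f)\<^sup>2 = (norm (trunc r f))\<^sup>2 + (norm (f - trunc r f))\<^sup>2"
      unfolding power2_norm_eq_inner by (simp add: inner_diff_left inner_diff_right inner_commute)
    then have "(norm (trunc r f))\<^sup>2 \<le> (norm f)\<^sup>2" by simp
    then show ?thesis unfolding f_def by (rule power2_le_imp_le) simp
  qed
  then have "{elementary_integrand F c | F c. finite F \<and> F \<subseteq> {0..T}} \<subseteq> {g. norm (trunc r g) \<le> norm g}"
    by blast
  moreover have "closed {g. norm (trunc r g) \<le> norm g}"
    by (intro closed_Collect_le continuous_intros L.continuous_on)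
  ultimately have "closure {elementary_integrand F c | F c. finite F \<and> F \<subseteq> {0..T}} \<subseteq> {g. norm (trunc r g) \<le> norm g}"
    by (rule closure_minimal)
  then show ?thesis unfolding elementary_integrand_dense_closure by blast
qed

text \<open>
  The weight $\delta = X_t - X_r$ satisfies $E[\delta e^{I(f)}] = 0$ for every \<open>f\<close> in the span of the
  integrands up to time \<open>r\<close>, hence it integrates to $0$ over every event of the past.
\<close>

lemma increments_orthogonal_imp_martingale:
  assumes orth: "\<And>u r t. 0 \<le> u \<Longrightarrow> u \<le> r \<Longrightarrow> r \<le> t \<Longrightarrow> t \<le> T \<Longrightarrow>
    (time_integrand t - time_integrand r) \<bullet> time_integrand u = 0"
  shows "martingale_own_filtration M T X"
  unfolding martingale_own_filtration_def
proof (intro conjI ballI allI impI)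
  show "X t \<in> borel_measurable (natural_filtration M X t)" "integrable M (X t)" if "t \<in> {0..T}" for t
    using that X_adapted X_integrable by auto
  fix r t assume rt: "0 \<le> r \<and> r \<le> t \<and> t \<le> T"
  then have in_T: "r \<in> {0..T}" "t \<in> {0..T}" by auto
  interpret C: finite_measure_subalgebra M "natural_filtration M X r"
    by (rule natural_filtration_cond_exp) (use rt in simp)
  define \<delta> where "\<delta> \<omega> = X t \<omega> - X r \<omega>" for \<omega>
  have rep: "represents (time_integrand t - time_integrand r) \<delta>"
    using represents_combination[OF in_T(2,1)[THEN represents_time_integrand], of 1 "-1"]
    by (simp add: \<delta>_def[abs_def])
  have [measurable]: "\<delta> \<in> borel_measurable M"
    using represents_square_integrable[OF rep] by (simp add: square_integrable_def)
  define V where "V = span (time_integrand ` {0..r})"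
  have V_orth: "(time_integrand t - time_integrand r) \<bullet> f = 0" if "f \<in> V" for f
    using that unfolding V_def
    by (induction rule: span_induct_alt) (use orth rt in \<open>auto simp: inner_add_right\<close>)
  have null: "(\<integral>\<omega>\<in>A. \<delta> \<omega> \<partial>M) = 0" if A: "A \<in> sets (natural_filtration M X r)" for A
  proof (rule laplace_null_imp_null_on_sigma_algebra[where V = V and S = "{0..r}" and Y = X and v = time_integrand])
    show "A \<in> sigma_sets (space M) {X s -` B \<inter> space M |s B. s \<in> {0..r} \<and> B \<in> sets borel}"
      using A by (simp only: sets_natural_filtration)
    show "AE \<omega> in M. X s \<omega> = wiener (time_integrand s) \<omega>" if "s \<in> {0..r}" for s
      using that rt by (intro represents_AE_wiener represents_time_integrand) auto
    show "X s \<in> borel_measurable M" if "s \<in> {0..r}" for s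
      using that rt by (intro X_measurable) auto
    show "square_integrable M \<delta>" by (rule represents_square_integrable[OF rep])
    show "subspace V" by (simp add: V_def)
    show "time_integrand s \<in> V" if "s \<in> {0..r}" for s
      using that by (auto simp: V_def intro: span_base)
    show "(\<integral>\<omega>. \<delta> \<omega> * exp (wiener f \<omega>) \<partial>M) = 0" if "f \<in> V" for f
      using S_transform_represents[OF rep, of f] V_orth[OF that] by (simp add: S_transform_eq)
  qed
  show "AE \<omega> in M. real_cond_exp M (natural_filtration M X r) (X t) \<omega> = X r \<omega>"
  proof (rule C.real_cond_exp_charact)
    fix A assume A: "A \<in> sets (natural_filtration M X r)"
    then have "A \<in> sets M" using C.subalg by (auto simp: subalgebra_def)
    then have "set_integrable M A (X t)" "set_integrable M A (X r)"
      using in_T[THEN X_integrable] unfolding set_integrable_def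
      by (auto intro!: integrable_mult_indicator simp del: real_scaleR_def)
    then have "(\<integral>\<omega>\<in>A. \<delta> \<omega> \<partial>M) = (\<integral>\<omega>\<in>A. X t \<omega> \<partial>M) - (\<integral>\<omega>\<in>A. X r \<omega> \<partial>M)"
      unfolding \<delta>_def by (rule set_integral_diff)
    then show "(\<integral>\<omega>\<in>A. X t \<omega> \<partial>M) = (\<integral>\<omega>\<in>A. X r \<omega> \<partial>M)" using null[OF A] by simp
  qed (use in_T rt X_integrable X_adapted in auto)
qed

lemma trunc_contraction_imp_increments_orthogonal:
  assumes contr: "\<And>r g. r \<in> {0..T} \<Longrightarrow> norm (trunc r g) \<le> norm g"
    and u: "0 \<le> u" "u \<le> r" and t: "r \<le> t" "t \<le> T"
  shows "(time_integrand t - time_integrand r) \<bullet> time_integrand u = 0"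
proof (rule contraction_kernel_orthogonal_fixed[of "trunc r"])
  have r: "r \<in> {0..T}" using u t by simp
  show "linear (trunc r)" using trunc_bounded_linear[OF r] by (rule bounded_linear.linear)
  show "norm (trunc r x) \<le> norm x" for x by (rule contr[OF r])
  show "trunc r (time_integrand t - time_integrand r) = 0"
    using r t u by (simp add: linear_diff[OF \<open>linear (trunc r)\<close>] trunc_time_integrand min_def)
  show "trunc r (time_integrand u) = time_integrand u"
    using r t u by (simp add: trunc_time_integrand min_def)
qed

theorem martingale_iff_trunc_contraction:
  "martingale_own_filtration M T X \<longleftrightarrow> (\<forall>r\<in>{0..T}. \<forall>g. norm (trunc r g) \<le> norm g)"
  using martingale_imp_trunc_contraction increments_orthogonal_imp_martingale
    trunc_contraction_imp_increments_orthogonal by blast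

end

theorem theorem4p11:
  fixes M :: "'a measure" and T :: real and X :: "real \<Rightarrow> 'a \<Rightarrow> real"
    and J :: "(real \<Rightarrow> real) \<Rightarrow> 'h::{real_inner, complete_space}"
  assumes "prob_space M" and "complete_measure M"
    and "0 < T"
    and "measurable_process M T X"
    and "centered_gaussian_process M T X"
    and "AE \<omega> in M. X 0 \<omega> = 0"
    and "integrand_space M T X J"
    and "has_indefinite_wiener_integral T J"
  shows "\<not> martingale_own_filtration M T X \<longleftrightarrow>
    (\<exists>h\<in>first_chaos M T X. \<exists>r\<in>{0..T}.
       (\<integral>\<omega>. (quasi_cond_exp M T X J r h \<omega>)\<^sup>2 \<partial>M) > (\<integral>\<omega>. (h \<omega>)\<^sup>2 \<partial>M))"
proof -
  interpret prob_space M by fact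
  interpret indefinite_gaussian_integrands M T X J
    by unfold_locales (fact assms)+
  show ?thesis
    unfolding second_moment_increases_iff martingale_iff_trunc_contraction by (simp add: not_le)
qed

end
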